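(* Let $d\ge 4$ be an integer, let $\omega\in[0,1)$, and let $X$ be a random vector in $\mathbb{R}^d$ with spherically symmetric Lebesgue density $x\mapsto f(\|x-\theta\|^2)$, where $f$ is known and $\theta\in\mathbb{R}^d$ is unknown. Suppose that $\mathbb{E}_0(\|X\|^2)<\infty$ and $\mathbb{E}_0(\|X\|^{-2})<\infty$. Let $\ell:[0,\infty)\to[0,\infty)$ be concave with $\ell(0)=0$, twice differentiable on $(0,\infty)$ and with $\ell'(t)>0$ for all $t>0$ (finiteness of $\ell'$ at $0$ is not required). Consider estimating $\theta$ under the balanced loss $$L(\theta,\delta)=\ell\left(\omega\|\delta-\delta_0(X)\|^2+(1-\omega)\|\delta-\theta\|^2\right),\qquad \delta_0(X)=X .$$ Let $s:[0,\infty)\to[0,1]$ be non-decreasing and concave, twice differentiable almost everywhere, and not identically zero, and for $a>0$ let $$\delta_{a,s}(X)=\left(1-a(1-\omega)\frac{s(\|X\|^2)}{\|X\|^2}\right)X .$$ Then $\delta_{a,s}(X)$ dominates $\delta_0(X)=X$ provided $$0<a<\frac{2(d-2)}{d\,\mathbb{E}^{*}_0(\|Z\|^{-2})},$$ where $\mathbb{E}^{*}_0$ denotes expectation for $\theta=0$ when $Z$ has density on $\mathbb{R}^d$ $$f^{*}(\|z-\theta\|^2)=\frac{\ell'\{(1-\omega)\|z-\theta\|^2\}\,f(\|z-\theta\|^2)}{\int_{\mathbb{R}^d}\ell'\{(1-\omega)\|z-\theta\|^2\}\,f(\|z-\theta\|^2)\,dz}.$$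
   Context: $\|\cdot\|$ is the Euclidean norm on $\mathbb{R}^d$. $\mathbb{E}_\theta$ denotes expectation when $X$ has density $f(\|x-\theta\|^2)$; in particular $\mathbb{E}_0$ is the case $\theta=0$. The (frequentist) risk of an estimator $\delta(X)$ is $R(\theta,\delta)=\mathbb{E}_\theta[L(\theta,\delta(X))]$. An estimator $\delta$ dominates $\delta_0$ if $R(\theta,\delta)\le R(\theta,\delta_0)$ for all $\theta\in\mathbb{R}^d$, with strict inequality for at least one $\theta$. If $\mathbb{E}^{*}_0(\|Z\|^{-2})=\infty$, the upper bound on $a$ is read as $0$ (no admissible $a$). *)

theory Defs
  imports "HOL-Probability.Probability"
begin

(* Sample space, parameter space and action space are all real ^ 'n, so the dimension d of the
   text is CARD('n).  The random vector X is the identity on the sample space, and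
   spherical_law f \<theta> is its distribution under the parameter \<theta>. *)
definition spherical_law :: "(real \<Rightarrow> real) \<Rightarrow> real ^ 'n \<Rightarrow> (real ^ 'n) measure" where
  "spherical_law f \<theta> = density lborel (\<lambda>x. ennreal (f ((norm (x - \<theta>))\<^sup>2)))"

definition balanced_loss ::
  "(real \<Rightarrow> real) \<Rightarrow> real \<Rightarrow> (real ^ 'n \<Rightarrow> real ^ 'n)
    \<Rightarrow> real ^ 'n \<Rightarrow> (real ^ 'n \<Rightarrow> real ^ 'n) \<Rightarrow> real ^ 'n \<Rightarrow> real" where
  "balanced_loss l \<omega> \<delta>0 \<theta> \<delta> x =
     l (\<omega> * (norm (\<delta> x - \<delta>0 x))\<^sup>2 + (1 - \<omega>) * (norm (\<delta> x - \<theta>))\<^sup>2)"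

(* The loss is nonnegative, so the risk always exists as an element of [0, \<infinity>]. *)
definition risk ::
  "(real \<Rightarrow> real) \<Rightarrow> (real \<Rightarrow> real) \<Rightarrow> real \<Rightarrow> (real ^ 'n \<Rightarrow> real ^ 'n)
    \<Rightarrow> real ^ 'n \<Rightarrow> (real ^ 'n \<Rightarrow> real ^ 'n) \<Rightarrow> ennreal" where
  "risk f l \<omega> \<delta>0 \<theta> \<delta> =
     (\<integral>\<^sup>+ x. ennreal (balanced_loss l \<omega> \<delta>0 \<theta> \<delta> x) \<partial>spherical_law f \<theta>)"

definition dominates ::
  "('p \<Rightarrow> 'e \<Rightarrow> ennreal) \<Rightarrow> 'e \<Rightarrow> 'e \<Rightarrow> bool" where
  "dominates R \<delta> \<delta>' \<longleftrightarrow>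
     (\<forall>\<theta>. R \<theta> \<delta> \<le> R \<theta> \<delta>') \<and> (\<exists>\<theta>. R \<theta> \<delta> < R \<theta> \<delta>')"

definition shrinkage_estimator ::
  "real \<Rightarrow> real \<Rightarrow> (real \<Rightarrow> real) \<Rightarrow> real ^ 'n \<Rightarrow> real ^ 'n" where
  "shrinkage_estimator \<omega> a s x =
     (1 - a * (1 - \<omega>) * (s ((norm x)\<^sup>2) / (norm x)\<^sup>2)) *\<^sub>R x"

(* Law of Z.  The weight is l' ((1 - \<omega>) |z - \<theta>|^2) f (|z - \<theta>|^2); at the single
   point z = \<theta>, where l' need not exist, deriv takes an unspecified value on a null set. *)
definition star_weight ::
  "(real \<Rightarrow> real) \<Rightarrow> (real \<Rightarrow> real) \<Rightarrow> real \<Rightarrow> real ^ 'n \<Rightarrow> real ^ 'n \<Rightarrow> ennreal" where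
  "star_weight f l \<omega> \<theta> z =
     ennreal (deriv l ((1 - \<omega>) * (norm (z - \<theta>))\<^sup>2) * f ((norm (z - \<theta>))\<^sup>2))"

definition star_law ::
  "(real \<Rightarrow> real) \<Rightarrow> (real \<Rightarrow> real) \<Rightarrow> real \<Rightarrow> real ^ 'n \<Rightarrow> (real ^ 'n) measure" where
  "star_law f l \<omega> \<theta> =
     density lborel
       (\<lambda>z. star_weight f l \<omega> \<theta> z / (\<integral>\<^sup>+ y. star_weight f l \<omega> \<theta> y \<partial>lborel))"

definition twice_differentiable_pos :: "(real \<Rightarrow> real) \<Rightarrow> bool" where
  "twice_differentiable_pos l \<longleftrightarrow>
     (\<forall>t>0. l differentiable (at t) \<and> deriv l differentiable (at t))"

(* The first derivative of s is only a function on the set D of points where it exists, and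
   its derivative is accordingly taken within D.  Requiring s' to exist on a whole neighbourhood
   of t would exclude concave functions whose kinks are dense. *)
definition twice_differentiable_ae_pos :: "(real \<Rightarrow> real) \<Rightarrow> bool" where
  "twice_differentiable_ae_pos s \<longleftrightarrow>
     (AE t in lborel. 0 < t \<longrightarrow>
        s differentiable (at t) \<and>
        deriv s differentiable (at t within {u. s differentiable (at u)}))"

end

theory Submission
  imports Defs
begin

text \<open>Write \<open>h x = s (norm x ^ 2) / norm x ^ 2\<close> and \<open>z = x - \<theta>\<close>. Bounding \<open>l\<close> by its tangent at
  \<open>(1 - \<omega>) * norm z ^ 2\<close> and using \<open>s\<^sup>2 \<le> s\<close> bounds the risk difference by a positive multiple of the integral
  of \<open>h x * (a - 2 * (z \<bullet> x))\<close> against the unnormalised density of the star law. Conditionally on \<open>norm z = r\<close>,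
  the divergence theorem and \<open>div (h x * x) \<ge> (d - 2) * h x\<close> give
  \<open>E (h x * (z \<bullet> x)) \<ge> (d - 2) / d * r\<^sup>2 * S r\<close>, where \<open>S r\<close> is the mean of \<open>h\<close> over the sphere of radius
  \<open>r\<close> around \<open>\<theta>\<close>: for \<open>d \<ge> 4\<close> the function \<open>h\<close> is superharmonic, so its ball means dominate \<open>S\<close>.
  What remains is \<open>r\<^sup>2 * S r * (a / r\<^sup>2 - 2 * (d - 2) / d)\<close>. Here \<open>r\<^sup>2 * S r\<close> is nondecreasing, again by
  superharmonicity, because the sphere means are symmetric in \<open>r\<close> and \<open>norm \<theta>\<close>; the last factor is decreasing,
  so the integral is at most a positive multiple of that of the last factor, which is negative by the bound on \<open>a\<close>.

  All means over a sphere depend only on the law of the cosine \<open>\<tau>\<close> of the angle with \<open>\<theta>\<close>. That law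
  satisfies \<open>(d - 1) * E (\<tau> * \<psi> \<tau>) = E ((1 - \<tau>\<^sup>2) * \<psi>' \<tau>)\<close>, which replaces the divergence theorem.\<close>

section \<open>Differentiation under the integral and translation invariance\<close>

text \<open>Three obstacles shape the details. The function \<open>h\<close> is singular at the
  origin and \<open>s\<close> may have kinks, so the inequalities on spheres are proved for smooth,
  nonsingular profiles and carried over by dominated convergence at every radius other than
  \<open>norm \<theta>\<close>. Next, \<open>deriv l\<close> may be unbounded near 0; concavity and
  \<open>l 0 = 0\<close> give \<open>deriv l v \<le> l v / v\<close>, and the inverse moment of the
  density pays for that growth. Finally, neither a surface measure nor an integral over a ball is
  formed: the cosine is taken of a uniform point of the unit ball, and each comparison with a ball
  mean is done in differentiated form, by the sign of a derivative in the radius. The dimension 4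
  comes from half the Laplacian of \<phi>(|x|^2), which is d \<phi>' + 2 t \<phi>''. For \<phi>(t) =
  s(t) / t and k = -\<phi>' \<ge> 0 it equals (4 - d) k + 2 s'', which is at most 0 when d \<ge> 4
  and s is concave. In the bound on \<open>a\<close>, the factor 2 is that of the cross term in the
  squared norm, and (d - 2) / d compares the lower bound d - 2 for the divergence with the
  divergence d of the identity field.\<close>

lemma has_field_derivative_integral:
  fixes f f' :: "real \<Rightarrow> 'a \<Rightarrow> real"
  assumes ae: "AE x in M. x \<in> A"
    and int: "\<And>t. integrable M (f t)"
    and der: "\<And>t x. \<bar>t - t0\<bar> < 1 \<Longrightarrow> x \<in> A \<Longrightarrow> ((\<lambda>t. f t x) has_field_derivative f' t x) (at t)"
    and bnd: "\<And>t x. \<bar>t - t0\<bar> < 1 \<Longrightarrow> x \<in> A \<Longrightarrow> \<bar>f' t x\<bar> \<le> w x"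
    and w: "integrable M w" and meas: "f' t0 \<in> borel_measurable M"
  shows "((\<lambda>t. \<integral>x. f t x \<partial>M) has_field_derivative (\<integral>x. f' t0 x \<partial>M)) (at t0)"
  unfolding has_field_derivative_iff tendsto_at_iff_sequentially
proof (intro allI impI)
  fix X :: "nat \<Rightarrow> real" assume X: "\<forall>i. X i \<in> UNIV - {t0}" "X \<longlonglongrightarrow> t0"
  from X(2) have "eventually (\<lambda>i. \<bar>X i - t0\<bar> < 1) sequentially"
    unfolding tendsto_iff dist_real_def by (auto dest: spec[of _ 1])
  then obtain N where N: "\<And>i. i \<ge> N \<Longrightarrow> \<bar>X i - t0\<bar> < 1"
    unfolding eventually_sequentially by blast
  \<comment> \<open>The mean value theorem turns the bound on \<open>f'\<close> into the same bound
    for difference quotients, but only within distance 1 of \<open>t0\<close>. This is why the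
    sequence is cut off at \<open>N\<close> before dominated convergence is applied.\<close>
  have q: "\<bar>(f (X i) x - f t0 x) / (X i - t0)\<bar> \<le> w x" if "i \<ge> N" "x \<in> A" for i x
  proof -
    have "norm (f (X i) x - f t0 x) \<le> w x * norm (X i - t0)"
    proof (rule field_differentiable_bound[where S = "{t0 - 1<..<t0 + 1}" and f' = "\<lambda>t. f' t x"])
      show "((\<lambda>t. f t x) has_field_derivative f' t x) (at t within {t0 - 1<..<t0 + 1})"
        if "t \<in> {t0 - 1<..<t0 + 1}" for t
        by (rule DERIV_subset[OF der]) (use that \<open>x \<in> A\<close> in auto)
      show "norm (f' t x) \<le> w x" if "t \<in> {t0 - 1<..<t0 + 1}" for t
        using bnd[of t x] that \<open>x \<in> A\<close> by auto
    qed (use N[OF that(1)] in auto)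
    moreover have "X i - t0 \<noteq> 0" using X(1) by auto
    ultimately show ?thesis by (simp add: abs_divide divide_le_eq)
  qed
  have "(\<lambda>i. \<integral>x. (f (X (i + N)) x - f t0 x) / (X (i + N) - t0) \<partial>M) \<longlonglongrightarrow> (\<integral>x. f' t0 x \<partial>M)"
  proof (rule integral_dominated_convergence[where w = w])
    show "AE x in M. (\<lambda>i. (f (X (i + N)) x - f t0 x) / (X (i + N) - t0)) \<longlonglongrightarrow> f' t0 x"
      using ae
    proof eventually_elim
      fix x assume "x \<in> A"
      from der[of t0 x] this have "((\<lambda>y. (f y x - f t0 x) / (y - t0)) \<longlongrightarrow> f' t0 x) (at t0)"
        by (simp add: has_field_derivative_iff)
      then have "((\<lambda>y. (f y x - f t0 x) / (y - t0)) \<circ> X) \<longlonglongrightarrow> f' t0 x"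
        unfolding tendsto_at_iff_sequentially using X by blast
      then show "(\<lambda>i. (f (X (i + N)) x - f t0 x) / (X (i + N) - t0)) \<longlonglongrightarrow> f' t0 x"
        unfolding comp_def by (rule LIMSEQ_ignore_initial_segment)
    qed
    show "AE x in M. norm ((f (X (i + N)) x - f t0 x) / (X (i + N) - t0)) \<le> w x" for i
      using ae by eventually_elim (use q in auto)
  qed (use int w meas in \<open>auto intro!: borel_measurable_integrable\<close>)
  moreover have "(\<integral>x. (f u x - f t0 x) / v \<partial>M) = ((\<integral>x. f u x \<partial>M) - (\<integral>x. f t0 x \<partial>M)) / v" for u v
    by (simp add: int)
  ultimately have "(\<lambda>i. ((\<integral>x. f (X (i + N)) x \<partial>M) - (\<integral>x. f t0 x \<partial>M)) / (X (i + N) - t0)) \<longlonglongrightarrow> (\<integral>x. f' t0 x \<partial>M)"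
    by (simp only:)
  then show "((\<lambda>y. ((\<integral>x. f y x \<partial>M) - (\<integral>x. f t0 x \<partial>M)) / (y - t0)) \<circ> X) \<longlonglongrightarrow> (\<integral>x. f' t0 x \<partial>M)"
    unfolding comp_def by (rule LIMSEQ_offset)
qed

lemma integral_lborel_shift:
  fixes F :: "'a::euclidean_space \<Rightarrow> real"
  shows "(\<integral>x. F (x + c) \<partial>lborel) = (\<integral>x. F x \<partial>lborel)"
    and "integrable lborel (\<lambda>x. F (x + c)) \<longleftrightarrow> integrable lborel F"
proof -
  have e: "distr lborel lborel ((+) c) = (lborel :: 'a measure)"
    using lborel_distr_plus[of c] by (simp cong: distr_cong)
  have m: "(+) c \<in> measurable lborel lborel" by simp
  have b: "integrable lborel F \<longleftrightarrow> integrable lborel (\<lambda>x. F (x + c))" if "F \<in> borel_measurable lborel" for F :: "'a \<Rightarrow> real"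
    using integrable_distr_eq[OF m, of F] that unfolding e by (simp add: add.commute)
  \<comment> \<open>Translating back recovers measurability of \<open>F\<close>, so the equivalence
    holds for arbitrary \<open>F\<close>; without integrability both integrals have the default
    value 0.\<close>
  have m2: "F \<in> borel_measurable lborel" if "(\<lambda>x. F (x + c)) \<in> borel_measurable lborel"
    using measurable_compose[OF _ that, of "\<lambda>x. x - c" lborel] by simp
  show "integrable lborel (\<lambda>x. F (x + c)) \<longleftrightarrow> integrable lborel F"
    using b[of F] m2 borel_measurable_integrable by blast
  then show "(\<integral>x. F (x + c) \<partial>lborel) = (\<integral>x. F x \<partial>lborel)"
  proof (cases "integrable lborel F")
    case True
    then show ?thesis using integral_distr[OF m, of F] unfolding e
      by (simp add: add.commute borel_measurable_integrable)
  qed (simp add: not_integrable_integral_eq)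
qed

lemma nn_integral_lborel_shift:
  fixes F :: "'a::euclidean_space \<Rightarrow> ennreal"
  assumes [measurable]: "F \<in> borel_measurable borel"
  shows "(\<integral>\<^sup>+x. F (x + c) \<partial>lborel) = (\<integral>\<^sup>+x. F x \<partial>lborel)"
proof -
  have e: "distr lborel lborel ((+) c) = (lborel :: 'a measure)"
    using lborel_distr_plus[of c] by (simp cong: distr_cong)
  show ?thesis using nn_integral_distr[of "(+) c" lborel lborel F] unfolding e by (simp add: add.commute)
qed

lemma integrable_continuous_compact_support:
  fixes F :: "'a::euclidean_space \<Rightarrow> real"
  assumes "continuous_on UNIV F" "\<And>x. norm x > R \<Longrightarrow> F x = 0"
  shows "integrable lborel F"
proof -
  have "integrable lborel (\<lambda>x. indicator (cball 0 R) x *\<^sub>R F x)"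
    by (rule borel_integrable_compact) (auto intro: continuous_on_subset[OF assms(1)])
  also have "(\<lambda>x. indicator (cball 0 R) x *\<^sub>R F x) = F"
    using assms(2) by (fastforce simp: indicator_def)
  finally show ?thesis .
qed

text \<open>The integral of the translate of \<open>F\<close> by \<open>t *\<^sub>R e\<close> does
  not depend on \<open>t\<close>; differentiating it at 0 under the integral gives the claim. A
  shift by less than 1 enlarges the support ball by at most 1, which yields the dominating
  function.\<close>

lemma integral_directional_derivative_zero:
  fixes F F' :: "'a::euclidean_space \<Rightarrow> real"
  assumes der: "\<And>x. ((\<lambda>t. F (x + t *\<^sub>R e)) has_field_derivative F' x) (at 0)"
    and F: "integrable lborel F" and cont: "continuous_on UNIV F'"
    and supp: "\<And>x. norm x > R \<Longrightarrow> F' x = 0"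
    and e: "norm e \<le> 1"
  shows "(\<integral>x. F' x \<partial>lborel) = 0"
proof -
  have "compact (F' ` cball 0 R)"
    by (intro compact_continuous_image continuous_on_subset[OF cont]) auto
  then obtain B where B: "\<And>x. x \<in> cball 0 R \<Longrightarrow> \<bar>F' x\<bar> \<le> B"
    by (metis (no_types, lifting) bounded_iff compact_imp_bounded image_eqI real_norm_def)
  have B': "\<bar>F' x\<bar> \<le> \<bar>B\<bar>" for x
    using B[of x] supp[of x] by (cases "norm x \<le> R") auto
  have "((\<lambda>t. \<integral>x. F (x + t *\<^sub>R e) \<partial>lborel) has_field_derivative (\<integral>x. F' (x + 0 *\<^sub>R e) \<partial>lborel)) (at 0)"
  proof (rule has_field_derivative_integral[where A = UNIV and w = "\<lambda>x. \<bar>B\<bar> * indicator (cball 0 (R + 1)) x"])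
    show "((\<lambda>t. F (x + t *\<^sub>R e)) has_field_derivative F' (x + t *\<^sub>R e)) (at t)" for t x
    proof -
      have "((\<lambda>u. F ((x + t *\<^sub>R e) + (u - t) *\<^sub>R e)) has_field_derivative F' (x + t *\<^sub>R e) * 1) (at t)"
        by (rule DERIV_chain2[where f = "\<lambda>v. F ((x + t *\<^sub>R e) + v *\<^sub>R e)"])
           (use der[of "x + t *\<^sub>R e"] in \<open>auto intro!: derivative_eq_intros\<close>)
      then show ?thesis by (simp add: algebra_simps)
    qed
    show "\<bar>F' (x + t *\<^sub>R e)\<bar> \<le> \<bar>B\<bar> * indicator (cball 0 (R + 1)) x" if "\<bar>t - 0\<bar> < 1" for t x
    proof (cases "norm x \<le> R + 1")
      case False
      have "norm x \<le> norm (x + t *\<^sub>R e) + norm (t *\<^sub>R e)" by (metis add_diff_cancel norm_triangle_ineq4)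
      also have "norm (t *\<^sub>R e) \<le> 1" using that e by (simp add: mult_le_one)
      finally have "norm (x + t *\<^sub>R e) > R" using False by simp
      then show ?thesis using supp by simp
    qed (use B' in simp)
    show "integrable lborel (\<lambda>x. F (x + t *\<^sub>R e))" for t using F by (simp add: integral_lborel_shift)
    show "integrable lborel (\<lambda>x::'a. \<bar>B\<bar> * indicator (cball 0 (R + 1)) x)"
      by (intro integrable_mult_right integrable_real_indicator) (use emeasure_lborel_cball_finite[of "0::'a" "R + 1"] in auto)
    show "(\<lambda>x. F' (x + 0 *\<^sub>R e)) \<in> borel_measurable lborel"
      using cont by (simp add: borel_measurable_continuous_onI)
  qed simp
  then have "((\<lambda>t. \<integral>x. F x \<partial>lborel) has_field_derivative (\<integral>x. F' x \<partial>lborel)) (at 0)"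
    by (simp add: integral_lborel_shift)
  then show ?thesis using DERIV_const DERIV_unique by blast
qed

section \<open>Polar decomposition of Lebesgue measure\<close>

definition direction_cos :: "'a::euclidean_space \<Rightarrow> 'a \<Rightarrow> real" where
  "direction_cos e x = inner e x / norm x"

text \<open>The cosine is unchanged by positive dilations, so a uniform point of the ball gives it
  the same law as a uniform point of the sphere. Using the ball keeps everything within Lebesgue
  measure.\<close>

definition cap_law :: "'a::euclidean_space \<Rightarrow> real measure" where
  "cap_law e = distr (uniform_measure lborel (cball 0 1)) borel (direction_cos e)"

lemma measurable_direction_cos [measurable]: "direction_cos e \<in> borel_measurable borel"
  unfolding direction_cos_def by measurable

lemma abs_direction_cos_le: "norm e = 1 \<Longrightarrow> \<bar>direction_cos e x\<bar> \<le> 1"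
  using Cauchy_Schwarz_ineq2[of e x] by (cases "x = 0") (auto simp: direction_cos_def divide_le_eq)

lemma direction_cos_scaleR: "c > 0 \<Longrightarrow> direction_cos e (c *\<^sub>R x) = direction_cos e x"
  by (simp add: direction_cos_def)

lemma sets_cap_law [simp, measurable_cong]: "sets (cap_law e) = sets borel"
  and space_cap_law [simp]: "space (cap_law e) = UNIV"
  by (simp_all add: cap_law_def)

lemma emeasure_unit_cball:
  "emeasure lborel (cball (0::'a::euclidean_space) 1) \<noteq> 0"
  "emeasure lborel (cball (0::'a::euclidean_space) 1) \<noteq> \<infinity>"
  using content_cball_pos[of 1 "0::'a"] emeasure_lborel_cball_finite[of "0::'a" 1]
  by (auto simp: measure_def)

lemma prob_space_cap_law: "prob_space (cap_law e)"
  unfolding cap_law_def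
  by (intro prob_space.prob_space_distr prob_space_uniform_measure emeasure_unit_cball) measurable

lemma AE_cap_law:
  assumes "norm e = 1" shows "AE \<tau> in cap_law e. \<bar>\<tau>\<bar> \<le> 1"
  unfolding cap_law_def by (subst AE_distr_iff) (use abs_direction_cos_le[OF assms] in auto)

text \<open>A cone is mapped to itself by the dilation with factor \<open>r\<close>, and that
  dilation multiplies Lebesgue measure by the d-th power of \<open>r\<close>.\<close>

lemma emeasure_norm_cone:
  fixes e :: "'a::euclidean_space"
  assumes [measurable]: "B \<in> sets borel" and r: "r > 0"
  shows "emeasure lborel {x. norm x \<le> r \<and> direction_cos e x \<in> B}
    = ennreal (r ^ DIM('a)) * emeasure lborel {x. norm x \<le> 1 \<and> direction_cos e x \<in> B}"
proof -
  have "emeasure lborel {x. norm x \<le> r \<and> direction_cos e x \<in> B}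
      = emeasure (density (distr lborel borel (\<lambda>x. 0 + r *\<^sub>R x)) (\<lambda>_. \<bar>r\<bar> ^ DIM('a)))
          {x. norm x \<le> r \<and> direction_cos e x \<in> B}"
    by (subst lborel_affine[of r "0::'a"]) (use r in auto)
  also have "\<dots> = ennreal (r ^ DIM('a)) * emeasure (distr lborel borel (\<lambda>x. r *\<^sub>R x)) {x. norm x \<le> r \<and> direction_cos e x \<in> B}"
    using r by (subst emeasure_density) (auto simp: nn_integral_cmult)
  also have "emeasure (distr lborel borel (\<lambda>x. r *\<^sub>R x)) {x. norm x \<le> r \<and> direction_cos e x \<in> B}
     = emeasure lborel {x. norm x \<le> 1 \<and> direction_cos e x \<in> B}"
    using r by (subst emeasure_distr) (auto simp: vimage_def direction_cos_scaleR)
  finally show ?thesis .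
qed

lemma emeasure_cap_law:
  fixes e :: "'a::euclidean_space"
  assumes [measurable]: "B \<in> sets borel"
  shows "emeasure (cap_law e) B
    = emeasure lborel {x. norm x \<le> 1 \<and> direction_cos e x \<in> B} / emeasure lborel (cball (0::'a) 1)"
proof -
  have *: "cball 0 1 \<inter> (direction_cos e -` B) = {x. norm x \<le> 1 \<and> direction_cos e x \<in> B}" by auto
  have "emeasure (cap_law e) B = emeasure (uniform_measure lborel (cball 0 1)) (direction_cos e -` B)"
    unfolding cap_law_def by (subst emeasure_distr) auto
  also have "\<dots> = emeasure lborel (cball 0 1 \<inter> (direction_cos e -` B)) / emeasure lborel (cball (0::'a) 1)"
    by (subst emeasure_uniform_measure) (auto simp: measurable_sets_borel[OF measurable_direction_cos])
  finally show ?thesis unfolding * .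
qed

lemma emeasure_cone:
  fixes e :: "'a::euclidean_space"
  assumes [measurable]: "B \<in> sets borel"
  shows "emeasure lborel {x. norm x \<le> r \<and> direction_cos e x \<in> B}
    = emeasure lborel {x::'a. norm x \<le> r} * emeasure (cap_law e) B"
proof (cases "r > 0")
  case True
  have c: "cball (0::'a) 1 = {x. norm x \<le> 1}" by auto
  have "emeasure lborel {x. norm x \<le> r \<and> direction_cos e x \<in> B} =
    (ennreal (r ^ DIM('a)) * emeasure lborel {x::'a. norm x \<le> 1}) * emeasure (cap_law e) B"
    unfolding emeasure_norm_cone[OF assms True] emeasure_cap_law[OF assms] c[symmetric] mult.assoc
    using emeasure_unit_cball[where 'a = 'a]
    by (subst ennreal_times_divide)
      (simp add: ennreal_times_divide[symmetric] ennreal_divide_self top.not_eq_extremum mult.commute[of "emeasure lborel (cball 0 1)"])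
  also have "ennreal (r ^ DIM('a)) * emeasure lborel {x::'a. norm x \<le> 1} = emeasure lborel {x::'a. norm x \<le> r}"
    using emeasure_norm_cone[OF _ True, of UNIV e] by simp
  finally show ?thesis .
next
  \<comment> \<open>For \<open>r \<le> 0\<close> the set lies in the single point 0, and both sides
    vanish.\<close>
  case False
  have "emeasure lborel {x::'a. norm x \<le> r} \<le> emeasure lborel {0::'a}"
  proof (rule emeasure_mono)
    show "{x::'a. norm x \<le> r} \<subseteq> {0}"
      using False by (auto simp: not_less) (metis norm_le_zero_iff order_trans)
  qed simp
  then have 0: "emeasure lborel {x::'a. norm x \<le> r} = 0" by simp
  have "emeasure lborel {x. norm x \<le> r \<and> direction_cos e x \<in> B} \<le> emeasure lborel {x::'a. norm x \<le> r}"
    by (rule emeasure_mono) auto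
  then show ?thesis unfolding 0 by simp
qed

lemma emeasure_norm_law:
  "emeasure (distr lborel borel (norm :: 'a::euclidean_space \<Rightarrow> real)) {..r} \<noteq> \<infinity>"
proof -
  have "emeasure (distr lborel borel (norm :: 'a \<Rightarrow> real)) {..r} = emeasure lborel (cball (0::'a) r)"
    by (subst emeasure_distr) (auto intro!: arg_cong[where f = "emeasure lborel"])
  then show ?thesis using emeasure_lborel_cball_finite[of "0::'a" r] by simp
qed

lemma sigma_finite_norm_law:
  "sigma_finite_measure (distr lborel borel (norm :: 'a::euclidean_space \<Rightarrow> real))"
  by standard
    (use emeasure_norm_law[where 'a = 'a] in \<open>auto intro!: exI[of _ "range (\<lambda>n::nat. {..real n})"] simp: real_arch_simple\<close>)

text \<open>Norm and cosine are independent under Lebesgue measure. Scaling gives the product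
  formula only for balls cut with cones; for a fixed set of cosines both sides are measures in the
  radius, and half-lines form an intersection-stable generator on which they are finite.\<close>

lemma polar_decomposition:
  fixes e :: "'a::euclidean_space"
  shows "distr lborel borel (norm :: 'a \<Rightarrow> real) \<Otimes>\<^sub>M cap_law e
    = distr lborel (borel \<Otimes>\<^sub>M borel) (\<lambda>x::'a. (norm x, direction_cos e x))"
proof (rule pair_measure_eqI)
  let ?M = "distr lborel borel (norm :: 'a \<Rightarrow> real)"
  show "sigma_finite_measure (cap_law e)"
    using prob_space_cap_law prob_space_imp_sigma_finite by blast
  show "sigma_finite_measure ?M" by (rule sigma_finite_norm_law)
  show "sets (?M \<Otimes>\<^sub>M cap_law e) = sets (distr lborel (borel \<Otimes>\<^sub>M borel) (\<lambda>x::'a. (norm x, direction_cos e x)))"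
    by (simp cong: sets_pair_measure_cong)
  fix A B assume A: "A \<in> sets ?M" and "B \<in> sets (cap_law e)"
  then have [measurable]: "A \<in> sets borel" "B \<in> sets borel" by auto
  let ?N1 = "density ?M (\<lambda>_. emeasure (cap_law e) B)"
  let ?N2 = "distr (density lborel (indicator {x. direction_cos e x \<in> B})) borel (norm :: 'a \<Rightarrow> real)"
  have N2: "emeasure ?N2 A = emeasure lborel {x::'a. norm x \<in> A \<and> direction_cos e x \<in> B}"
    if [measurable]: "A \<in> sets borel" for A
  proof -
    have "emeasure ?N2 A = emeasure (density lborel (indicator {x. direction_cos e x \<in> B})) {x::'a. norm x \<in> A}"
      by (subst emeasure_distr) (auto simp: vimage_def)
    also have "\<dots> = (\<integral>\<^sup>+x. indicator {x::'a. norm x \<in> A \<and> direction_cos e x \<in> B} x \<partial>lborel)"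
      by (subst emeasure_density, simp, simp, intro nn_integral_cong) (auto simp: indicator_def)
    also have "\<dots> = emeasure lborel {x::'a. norm x \<in> A \<and> direction_cos e x \<in> B}"
      by (rule nn_integral_indicator) measurable
    finally show ?thesis .
  qed
  have N1: "emeasure ?N1 A = emeasure lborel {x::'a. norm x \<in> A} * emeasure (cap_law e) B"
    if [measurable]: "A \<in> sets borel" for A
  proof -
    have "emeasure ?N1 A = emeasure (cap_law e) B * emeasure ?M A"
      by (subst emeasure_density) (simp_all add: nn_integral_cmult)
    also have "emeasure ?M A = emeasure lborel {x::'a. norm x \<in> A}"
      by (subst emeasure_distr) (simp_all add: vimage_def)
    finally show ?thesis by (simp only: mult.commute)
  qed
  have "?N1 = ?N2"
  proof (rule measure_eqI_generator_eq[where E = "range (\<lambda>r. {..r})" and \<Omega> = UNIV and A = "\<lambda>n. {..real n}"])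
    show "Int_stable (range (\<lambda>r::real. {..r}))"
      by (auto simp: Int_stable_def)
    show "emeasure ?N1 X = emeasure ?N2 X" if "X \<in> range (\<lambda>r. {..r})" for X
    proof -
      from that obtain r where X: "X = {..r}" by blast
      have "X \<in> sets borel" unfolding X by simp
      then show ?thesis by (simp only: N1 N2, simp only: X atMost_iff, simp add: emeasure_cone)
    qed
    show "sets ?N1 = sigma_sets UNIV (range (\<lambda>r. {..r}))" "sets ?N2 = sigma_sets UNIV (range (\<lambda>r. {..r}))"
      by (simp_all add: borel_eq_atMost)
    show "emeasure ?N1 {..real i} \<noteq> \<infinity>" for i
    proof -
      interpret prob_space "cap_law e" by (rule prob_space_cap_law)
      have "emeasure lborel {x::'a. norm x \<in> {..real i}} = emeasure ?M {..real i}"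
        by (subst emeasure_distr) (simp_all add: vimage_def)
      then show ?thesis
        using emeasure_norm_law[of "real i", where 'a = 'a] emeasure_finite[of B] unfolding N1[OF borel_closed[OF closed_atMost]]
        by (simp only: infinity_ennreal_def ennreal_mult_eq_top_iff) simp
    qed
  qed (auto simp: real_arch_simple)
  from arg_cong[OF this, of "\<lambda>M. emeasure M A"]
  have *: "emeasure lborel {x::'a. norm x \<in> A} * emeasure (cap_law e) B = emeasure lborel {x::'a. norm x \<in> A \<and> direction_cos e x \<in> B}"
    by (simp only: N1 N2 \<open>A \<in> sets borel\<close>)
  show "emeasure ?M A * emeasure (cap_law e) B
     = emeasure (distr lborel (borel \<Otimes>\<^sub>M borel) (\<lambda>x::'a. (norm x, direction_cos e x))) (A \<times> B)"
    by (subst (1 2) emeasure_distr) (simp_all add: vimage_def *)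
qed


text \<open>The radius stays written as \<open>norm x\<close> under Lebesgue measure, so neither a
  radial density nor a normalising constant appears; the effect is to average over directions at
  fixed norm.\<close>

lemma nn_integral_polar:
  fixes e :: "'a::euclidean_space" and G :: "real \<times> real \<Rightarrow> ennreal"
  assumes [measurable]: "G \<in> borel_measurable (borel \<Otimes>\<^sub>M borel)"
  shows "(\<integral>\<^sup>+x. G (norm x, direction_cos e x) \<partial>lborel)
    = (\<integral>\<^sup>+x. (\<integral>\<^sup>+\<tau>. G (norm (x::'a), \<tau>) \<partial>cap_law e) \<partial>lborel)"
proof -
  interpret prob_space "cap_law e" by (rule prob_space_cap_law)
  have "(\<integral>\<^sup>+x. G (norm x, direction_cos e x) \<partial>lborel)
      = (\<integral>\<^sup>+p. G p \<partial>distr lborel (borel \<Otimes>\<^sub>M borel) (\<lambda>x::'a. (norm x, direction_cos e x)))"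
    by (subst nn_integral_distr) auto
  also have "\<dots> = (\<integral>\<^sup>+r. (\<integral>\<^sup>+\<tau>. G (r, \<tau>) \<partial>cap_law e) \<partial>distr lborel borel (norm :: 'a \<Rightarrow> real))"
    unfolding polar_decomposition[symmetric]
    by (subst nn_integral_fst[symmetric]) (auto cong: measurable_cong_sets sets_pair_measure_cong)
  also have "\<dots> = (\<integral>\<^sup>+x. (\<integral>\<^sup>+\<tau>. G (norm (x::'a), \<tau>) \<partial>cap_law e) \<partial>lborel)"
    by (subst nn_integral_distr) auto
  finally show ?thesis .
qed

lemma integral_polar:
  fixes e :: "'a::euclidean_space" and G :: "real \<times> real \<Rightarrow> real"
  assumes G [measurable]: "G \<in> borel_measurable (borel \<Otimes>\<^sub>M borel)"
    and int: "integrable lborel (\<lambda>x::'a. G (norm x, direction_cos e x))"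
  shows "(\<integral>x. G (norm x, direction_cos e x) \<partial>lborel)
      = (\<integral>x. (\<integral>\<tau>. G (norm (x::'a), \<tau>) \<partial>cap_law e) \<partial>lborel)" (is ?A)
    and "integrable lborel (\<lambda>x. \<integral>\<tau>. G (norm (x::'a), \<tau>) \<partial>cap_law e)" (is ?B)
proof -
  interpret C: prob_space "cap_law e" by (rule prob_space_cap_law)
  let ?N = "distr lborel borel (norm :: 'a \<Rightarrow> real)"
  let ?P = "distr lborel (borel \<Otimes>\<^sub>M borel) (\<lambda>x::'a. (norm x, direction_cos e x))"
  interpret N: sigma_finite_measure ?N by (rule sigma_finite_norm_law)
  interpret pair_sigma_finite "cap_law e" ?N ..
  interpret Q: pair_sigma_finite ?N "cap_law e" ..
  have "integrable ?P G" using int by (subst integrable_distr_eq) auto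
  then have i: "integrable (?N \<Otimes>\<^sub>M cap_law e) G" unfolding polar_decomposition .
  have "(\<integral>x. G (norm x, direction_cos e x) \<partial>lborel) = (\<integral>p. G p \<partial>(?N \<Otimes>\<^sub>M cap_law e))"
    unfolding polar_decomposition by (subst integral_distr) auto
  also have "\<dots> = (\<integral>r. (\<integral>\<tau>. G (r, \<tau>) \<partial>cap_law e) \<partial>?N)"
    by (rule Q.integral_fst'[symmetric]) (rule i)
  also have "\<dots> = (\<integral>x. (\<integral>\<tau>. G (norm (x::'a), \<tau>) \<partial>cap_law e) \<partial>lborel)"
    by (subst integral_distr) auto
  finally show ?A .
  have "integrable ?N (\<lambda>r. \<integral>\<tau>. G (r, \<tau>) \<partial>cap_law e)"
    by (rule Q.integrable_fst'[OF i])
  then show ?B by (subst (asm) integrable_distr_eq) auto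
qed

section \<open>Integration by parts for the law of the cosine\<close>

lemma DERIV_max_zero_power2: "((\<lambda>y::real. (max 0 y)\<^sup>2) has_field_derivative 2 * max 0 y) (at y)"
proof (cases y "0::real" rule: linorder_cases)
  case less
  have "((\<lambda>y::real. 0) has_field_derivative 0) (at y)" by simp
  then show ?thesis using less
    by (rule_tac has_field_derivative_transform_within_open[where S = "{..<0}" and f = "\<lambda>y. 0"]) auto
next
  case greater
  have "((\<lambda>y::real. y\<^sup>2) has_field_derivative 2 * y) (at y)" by (auto intro!: derivative_eq_intros)
  then show ?thesis using greater
    by (rule_tac has_field_derivative_transform_within_open[where S = "{0<..}" and f = "\<lambda>y. y\<^sup>2"]) auto
next
  case equal
  have "((\<lambda>h. (max 0 h)\<^sup>2 / h) \<longlongrightarrow> 0) (at (0::real))"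
  proof (rule Lim_null_comparison)
    show "\<forall>\<^sub>F h in at 0. norm ((max 0 h)\<^sup>2 / h) \<le> \<bar>h\<bar>"
      by (intro always_eventually allI) (auto simp: max_def power2_eq_square)
    show "((\<lambda>h. \<bar>h\<bar>) \<longlongrightarrow> 0) (at (0::real))" by (rule tendsto_eq_intros | simp)+
  qed
  then show ?thesis unfolding equal by (simp add: has_field_derivative_iff)
qed

text \<open>A continuously differentiable radial cutoff, positive exactly on the open interval from
  1 to 2. It gives compact support and keeps away from the origin, where the cosine is
  discontinuous.\<close>

definition bump :: "real \<Rightarrow> real" where "bump r = (max 0 ((r - 1) * (2 - r)))\<^sup>2"
definition bump' :: "real \<Rightarrow> real" where "bump' r = 2 * max 0 ((r - 1) * (2 - r)) * (3 - 2 * r)"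

lemma bump_deriv: "(bump has_field_derivative bump' r) (at r)"
  unfolding bump_def[abs_def] bump'_def
  by (rule DERIV_chain2[where f = "\<lambda>y. (max 0 y)\<^sup>2", OF DERIV_max_zero_power2])
    (auto intro!: derivative_eq_intros)

lemma bump_zero: "r \<notin> {1<..<2} \<Longrightarrow> bump r = 0" "r \<notin> {1<..<2} \<Longrightarrow> bump' r = 0"
  unfolding bump_def bump'_def
  by (auto simp: max_def mult_le_0_iff zero_le_mult_iff not_less)

lemma bump_pos: "r \<in> {1<..<2} \<Longrightarrow> bump r > 0"
  unfolding bump_def by auto

lemma continuous_on_bump [continuous_intros]:
  "continuous_on S g \<Longrightarrow> continuous_on S (\<lambda>x. bump (g x))"
  "continuous_on S g \<Longrightarrow> continuous_on S (\<lambda>x. bump' (g x))"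
  unfolding bump_def bump'_def by (intro continuous_intros; assumption)+

lemma measurable_bump [measurable]: "bump \<in> borel_measurable borel" "bump' \<in> borel_measurable borel"
  by (intro borel_measurable_continuous_onI continuous_intros)+

text \<open>The second rate of change is the source of the factor \<open>1 - \<tau>\<^sup>2\<close>
  in the integration by parts.\<close>

lemma direction_cos_deriv:
  fixes e x :: "'a::euclidean_space"
  assumes e: "norm e = 1" and x: "x \<noteq> 0"
  shows "((\<lambda>t. norm (x + t *\<^sub>R e)) has_field_derivative direction_cos e x) (at 0)"
    and "((\<lambda>t. direction_cos e (x + t *\<^sub>R e)) has_field_derivative (1 - (direction_cos e x)\<^sup>2) / norm x) (at 0)"
proof -
  have ee: "inner e e = 1" using e by (simp add: norm_eq_1)
  have n: "norm (x + t *\<^sub>R e) = sqrt ((norm x)\<^sup>2 + 2 * t * inner e x + t\<^sup>2)" for t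
    unfolding norm_eq_sqrt_inner
    by (simp add: inner_add inner_commute ee power2_eq_square algebra_simps)
  show N: "((\<lambda>t. norm (x + t *\<^sub>R e)) has_field_derivative direction_cos e x) (at 0)"
    unfolding n direction_cos_def using x
    by (auto intro!: derivative_eq_intros simp: field_simps)
  have "((\<lambda>t. (inner e x + t) / norm (x + t *\<^sub>R e)) has_field_derivative
     (1 - (direction_cos e x)\<^sup>2) / norm x) (at 0)"
    using x by (auto intro!: derivative_eq_intros N simp: field_simps direction_cos_def power2_eq_square)
  then show "((\<lambda>t. direction_cos e (x + t *\<^sub>R e)) has_field_derivative (1 - (direction_cos e x)\<^sup>2) / norm x) (at 0)"
    by (simp add: direction_cos_def inner_add ee)
qed

lemma continuous_on_UNIV_zero_near_origin:
  fixes H :: "'a::euclidean_space \<Rightarrow> real"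
  assumes "continuous_on (- {0}) H" "\<And>x. norm x < 1 \<Longrightarrow> H x = 0"
  shows "continuous_on UNIV H"
proof -
  have "continuous_on (- {0} \<union> ball 0 1) H"
  proof (rule continuous_on_open_Un)
    show "continuous_on (ball 0 1) H"
      by (rule continuous_on_eq[where f = "\<lambda>_. 0"]) (use assms(2) in auto)
  qed (use assms(1) in auto)
  moreover have "- {0} \<union> ball 0 1 = (UNIV :: 'a set)" by auto
  ultimately show ?thesis by simp
qed

text \<open>\<open>G\<close> is the derivative in direction \<open>e\<close> of the compactly
  supported function \<open>bump (norm x) * \<psi> (direction_cos e x)\<close>, so its integral
  vanishes.\<close>

lemma bump_direction_integral:
  fixes e :: "'a::euclidean_space"
  assumes e: "norm e = 1"
    and der: "\<And>\<tau>. \<bar>\<tau>\<bar> \<le> 1 \<Longrightarrow> (\<psi> has_field_derivative \<psi>' \<tau>) (at \<tau>)"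
    and cont: "continuous_on {-1..1} \<psi>'"
  defines "G \<equiv> \<lambda>x::'a. bump' (norm x) * (direction_cos e x * \<psi> (direction_cos e x))
        + bump (norm x) / norm x * ((1 - (direction_cos e x)\<^sup>2) * \<psi>' (direction_cos e x))"
  shows "(\<integral>x. G x \<partial>lborel) = 0" and "integrable lborel G"
proof -
  let ?F = "\<lambda>x::'a. bump (norm x) * \<psi> (direction_cos e x)"
  have near0: "norm x < 1 \<Longrightarrow> ?F x = 0" "norm x < 1 \<Longrightarrow> G x = 0" for x
    by (simp_all add: G_def bump_zero)
  have c\<psi>: "continuous_on {-1..1} \<psi>"
    by (rule DERIV_continuous_on, rule DERIV_subset[OF der]) auto
  have dc: "continuous_on (- {0}) (direction_cos e)"
    unfolding direction_cos_def[abs_def] by (intro continuous_intros) auto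
  have im: "direction_cos e ` (- {0}) \<subseteq> {-1..1}" using abs_direction_cos_le[OF e] by (auto simp: abs_le_iff minus_le_iff)
  have d\<psi>: "continuous_on (- {0}) (\<lambda>x. \<psi> (direction_cos e x))"
    by (rule continuous_on_compose2[OF c\<psi> dc im])
  have d\<psi>': "continuous_on (- {0}) (\<lambda>x. \<psi>' (direction_cos e x))"
    by (rule continuous_on_compose2[OF cont dc im])
  have "continuous_on (- {0}) ?F"
    by (intro continuous_on_mult continuous_on_bump continuous_on_norm continuous_on_id d\<psi>)
  then have "continuous_on UNIV ?F"
    by (rule continuous_on_UNIV_zero_near_origin) (rule near0(1))
  then have F: "integrable lborel ?F"
    by (rule integrable_continuous_compact_support[where R = 2]) (simp add: bump_zero)
  have cG: "continuous_on UNIV G"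
  proof (rule continuous_on_UNIV_zero_near_origin)
    show "continuous_on (- {0}) G"
      unfolding G_def
      by (intro continuous_on_mult continuous_on_add continuous_on_divide continuous_on_diff continuous_on_power
          continuous_on_bump continuous_on_norm continuous_on_id continuous_on_const d\<psi> d\<psi>' dc) auto
  qed (rule near0(2))
  have D: "((\<lambda>t. ?F (x + t *\<^sub>R e)) has_field_derivative G x) (at 0)" for x
  proof (cases "norm x < 1")
    case True
    have o: "open {t. norm (x + t *\<^sub>R e) < 1}"
      by (intro open_Collect_less continuous_intros)
    show ?thesis unfolding near0(2)[OF True]
      by (rule has_field_derivative_transform_within_open[where f = "\<lambda>_. 0", OF _ o]) (use True in \<open>simp_all add: near0(1)\<close>)
  next
    case False
    then have x: "x \<noteq> 0" by auto
    have 1: "((\<lambda>t. bump (norm (x + t *\<^sub>R e))) has_field_derivative bump' (norm x) * direction_cos e x) (at 0)"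
      by (rule DERIV_chain2[where f = bump]) (use bump_deriv direction_cos_deriv(1)[OF e x] in auto)
    have 2: "((\<lambda>t. \<psi> (direction_cos e (x + t *\<^sub>R e))) has_field_derivative
        \<psi>' (direction_cos e x) * ((1 - (direction_cos e x)\<^sup>2) / norm x)) (at 0)"
      by (rule DERIV_chain2[where f = \<psi>])
        (use der[OF abs_direction_cos_le[OF e]] direction_cos_deriv(2)[OF e x] in auto)
    show ?thesis using DERIV_mult[OF 1 2] by (simp add: G_def algebra_simps diff_divide_distrib)
  qed
  have G2: "G x = 0" if "2 < norm x" for x using that by (simp add: G_def bump_zero)
  show "(\<integral>x. G x \<partial>lborel) = 0"
    by (rule integral_directional_derivative_zero[OF D F cG G2]) (use e in auto)
  show "integrable lborel G"
    by (rule integrable_continuous_compact_support[OF cG G2])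
qed


text \<open>Polar integration of \<open>bump_direction_integral\<close> gives a linear relation
  between the two means, whose coefficients depend on the cutoff alone. The special case of the
  identity for \<open>\<psi>\<close>, summed over an orthonormal basis, determines the ratio of
  these coefficients.\<close>

lemma cap_law_integration_by_parts:
  fixes e :: "'a::euclidean_space"
  assumes e: "norm e = 1"
    and der: "\<And>\<tau>. \<bar>\<tau>\<bar> \<le> 1 \<Longrightarrow> (\<psi> has_field_derivative \<psi>' \<tau>) (at \<tau>)"
    and cont: "continuous_on {-1..1} \<psi>'"
    and [measurable]: "\<psi> \<in> borel_measurable borel" "\<psi>' \<in> borel_measurable borel"
  shows "(real DIM('a) - 1) * (\<integral>\<tau>. \<tau> * \<psi> \<tau> \<partial>cap_law e) = (\<integral>\<tau>. (1 - \<tau>\<^sup>2) * \<psi>' \<tau> \<partial>cap_law e)"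
proof -
  interpret prob_space "cap_law e" by (rule prob_space_cap_law)
  \<comment> \<open>Regularity of \<open>\<psi>\<close> is known only on [-1, 1]. Clamping makes the
    integrands bounded and continuous on the whole line without changing their means, since the
    cosine lies in that interval.\<close>
  define c :: "real \<Rightarrow> real" where "c = (\<lambda>\<tau>. max (-1) (min 1 \<tau>))"
  have c: "c \<tau> = \<tau>" if "\<bar>\<tau>\<bar> \<le> 1" for \<tau> using that by (auto simp: c_def)
  have cc: "continuous_on UNIV c" unfolding c_def by (intro continuous_intros)
  have c1: "range c \<subseteq> {-1..1}" by (auto simp: c_def)
  have cont\<psi>: "continuous_on {-1..1} \<psi>"
    by (rule DERIV_continuous_on, rule DERIV_subset[OF der]) auto
  have cont2: "continuous_on {-1..1} (\<lambda>\<tau>. \<tau> * \<psi> \<tau>)" "continuous_on {-1..1} (\<lambda>\<tau>. (1 - \<tau>\<^sup>2) * \<psi>' \<tau>)"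
    by (intro continuous_intros cont\<psi> cont)+
  define u v where "u \<tau> = c \<tau> * \<psi> (c \<tau>)" and "v \<tau> = (1 - (c \<tau>)\<^sup>2) * \<psi>' (c \<tau>)" for \<tau>
  have cu: "continuous_on UNIV u" "continuous_on UNIV v"
    unfolding u_def v_def using continuous_on_compose2[OF cont2(1) cc c1] continuous_on_compose2[OF cont2(2) cc c1]
    by auto
  have [measurable]: "u \<in> borel_measurable borel" "v \<in> borel_measurable borel"
    by (intro borel_measurable_continuous_onI cu)+
  have bd: "\<exists>B. \<forall>\<tau>. \<bar>g (c \<tau>)\<bar> \<le> B" if "continuous_on {-1..1} g" for g :: "real \<Rightarrow> real"
  proof -
    have "bounded (g ` {-1..1})"
      by (intro compact_imp_bounded compact_continuous_image that) auto
    then obtain B where "\<forall>x\<in>{-1..1}. \<bar>g x\<bar> \<le> B" unfolding bounded_iff by auto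
    then have "\<bar>g (c \<tau>)\<bar> \<le> B" for \<tau> using c1 by blast
    then show ?thesis by blast
  qed
  obtain Bu where Bu: "\<And>\<tau>. \<bar>u \<tau>\<bar> \<le> Bu" using bd[OF cont2(1)] unfolding u_def by blast
  obtain Bv where Bv: "\<And>\<tau>. \<bar>v \<tau>\<bar> \<le> Bv" using bd[OF cont2(2)] unfolding v_def by blast
  have iu: "integrable (cap_law e) u" "integrable (cap_law e) v"
    by (rule integrable_const_bound[where B = Bu], use Bu in auto,
        rule integrable_const_bound[where B = Bv], use Bv in auto)
  define a b where "a = (\<integral>x. bump' (norm (x::'a)) \<partial>lborel)" and "b = (\<integral>x. bump (norm (x::'a)) / norm x \<partial>lborel)"
  have ia: "integrable lborel (\<lambda>x::'a. bump' (norm x))"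
    by (rule integrable_continuous_compact_support[where R = 2]) (auto intro!: continuous_intros simp: bump_zero)
  have ib: "integrable lborel (\<lambda>x::'a. bump (norm x) / norm x)"
  proof (rule integrable_continuous_compact_support[where R = 2])
    show "continuous_on UNIV (\<lambda>x::'a. bump (norm x) / norm x)"
      by (rule continuous_on_UNIV_zero_near_origin) (auto intro!: continuous_intros simp: bump_zero)
  qed (simp add: bump_zero)
  have "a * (\<integral>\<tau>. u \<tau> \<partial>cap_law e) + b * (\<integral>\<tau>. v \<tau> \<partial>cap_law e) = 0"
  proof -
    define G where "G p = bump' (fst p) * u (snd p) + bump (fst p) / fst p * v (snd p)" for p :: "real \<times> real"
    have [measurable]: "G \<in> borel_measurable (borel \<Otimes>\<^sub>M borel)" unfolding G_def by measurable
    have G: "(\<lambda>x::'a. G (norm x, direction_cos e x)) = (\<lambda>x. bump' (norm x) * (direction_cos e x * \<psi> (direction_cos e x))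
        + bump (norm x) / norm x * ((1 - (direction_cos e x)\<^sup>2) * \<psi>' (direction_cos e x)))"
      by (simp add: G_def u_def v_def c abs_direction_cos_le[OF e])
    note B = bump_direction_integral[where \<psi> = \<psi> and \<psi>' = \<psi>', OF e der cont, folded G]
    have "0 = (\<integral>x. (\<integral>\<tau>. G (norm (x::'a), \<tau>) \<partial>cap_law e) \<partial>lborel)"
      using integral_polar(1)[of G e] B by simp
    also have "\<dots> = (\<integral>x. bump' (norm (x::'a)) * (\<integral>\<tau>. u \<tau> \<partial>cap_law e) + bump (norm x) / norm x * (\<integral>\<tau>. v \<tau> \<partial>cap_law e) \<partial>lborel)"
      by (simp add: G_def iu)
    also have "\<dots> = a * (\<integral>\<tau>. u \<tau> \<partial>cap_law e) + b * (\<integral>\<tau>. v \<tau> \<partial>cap_law e)"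
      unfolding a_def b_def by (subst Bochner_Integration.integral_add) (use ia ib in \<open>auto simp del: times_divide_eq_left\<close>)
    finally show ?thesis by simp
  qed
  \<comment> \<open>The squared cosines with respect to the basis vectors sum to 1. Hence the
    coefficients of \<open>a\<close> add up to 1 and those of \<open>b\<close>, which are
    \<open>1 - \<tau>\<^sup>2\<close>, to d - 1.\<close>
  moreover have "a + (real DIM('a) - 1) * b = 0"
  proof -
    let ?G = "\<lambda>i x. bump' (norm x) * (direction_cos i x * direction_cos i x)
        + bump (norm x) / norm x * ((1 - (direction_cos i x)\<^sup>2) * 1)"
    have B: "(\<integral>x. ?G i x \<partial>lborel) = 0" "integrable lborel (?G i)" if "i \<in> Basis" for i :: 'a
      using bump_direction_integral[of i "\<lambda>x. x" "\<lambda>_. 1"] that by auto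
    have "(\<Sum>i\<in>Basis. ?G i x) = bump' (norm x) + (real DIM('a) - 1) * (bump (norm x) / norm x)" for x :: 'a
    proof (cases "x = 0")
      case False
      have "(\<Sum>i\<in>Basis. (inner i x)\<^sup>2) = (norm x)\<^sup>2"
        unfolding power2_norm_eq_inner using euclidean_inner[of x x] by (simp add: inner_commute power2_eq_square)
      then have s: "(\<Sum>i\<in>Basis. (direction_cos i x)\<^sup>2) = 1"
        using False by (simp add: direction_cos_def power_divide sum_divide_distrib[symmetric])
      have "(\<Sum>i\<in>Basis. ?G i x) = bump' (norm x) * (\<Sum>i\<in>Basis. (direction_cos i x)\<^sup>2)
         + bump (norm x) / norm x * (\<Sum>i\<in>Basis. 1 - (direction_cos i x)\<^sup>2)"
        unfolding sum.distrib sum_distrib_left by (simp add: power2_eq_square)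
      then show ?thesis by (simp add: sum_subtractf s)
    qed (simp add: bump_zero)
    then have "(\<integral>x. bump' (norm (x::'a)) + (real DIM('a) - 1) * (bump (norm x) / norm x) \<partial>lborel) = (\<integral>x. (\<Sum>i\<in>Basis. ?G i x) \<partial>(lborel::'a measure))"
      by simp
    also have "\<dots> = (\<Sum>i\<in>Basis. (\<integral>x. ?G i x \<partial>(lborel::'a measure)))"
      by (rule Bochner_Integration.integral_sum) (rule B(2))
    also have "\<dots> = 0" by (intro sum.neutral ballI B(1))
    finally show ?thesis
      unfolding a_def b_def by (subst (asm) Bochner_Integration.integral_add) (use ia ib in \<open>auto simp del: times_divide_eq_left times_divide_eq_right\<close>)
  qed
  \<comment> \<open>If \<open>b\<close> were 0, the cutoff would vanish almost everywhere on the
    open annulus where it is positive; that annulus contains \<open>(3/2) *\<^sub>R e\<close> and so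
    is not negligible.\<close>
  moreover have "b \<noteq> 0"
  proof
    assume "b = 0"
    then have "AE x in lborel. bump (norm (x::'a)) / norm x = 0"
      unfolding b_def by (subst (asm) integral_nonneg_eq_0_iff_AE[OF ib]) (auto simp: bump_def)
    then have "AE x in lborel. x \<notin> {x::'a. 1 < norm x \<and> norm x < 2}"
      by eventually_elim (use bump_pos in fastforce)
    moreover have o: "open {x::'a. 1 < norm x \<and> norm x < 2}"
      by (intro open_Collect_conj open_Collect_less continuous_intros)
    ultimately have "{x::'a. 1 < norm x \<and> norm x < 2} \<in> null_sets lborel"
      by (subst (asm) AE_iff_null_sets[symmetric]) auto
    then have "negligible {x::'a. 1 < norm x \<and> norm x < 2}"
      by (simp add: negligible_iff_null_sets null_sets_completionI)
    moreover have "(3/2) *\<^sub>R e \<in> {x::'a. 1 < norm x \<and> norm x < 2}" using e by simp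
    ultimately show False using open_not_negligible[OF o] by blast
  qed
  ultimately have "(real DIM('a) - 1) * (\<integral>\<tau>. u \<tau> \<partial>cap_law e) = (\<integral>\<tau>. v \<tau> \<partial>cap_law e)"
  proof -
    assume 1: "a * (\<integral>\<tau>. u \<tau> \<partial>cap_law e) + b * (\<integral>\<tau>. v \<tau> \<partial>cap_law e) = 0"
      and 2: "a + (real DIM('a) - 1) * b = 0" and b: "b \<noteq> 0"
    from 2 have a: "a = - (real DIM('a) - 1) * b" by (simp only: eq_neg_iff_add_eq_0 minus_mult_left[symmetric])
    from 1 have "b * ((\<integral>\<tau>. v \<tau> \<partial>cap_law e) - (real DIM('a) - 1) * (\<integral>\<tau>. u \<tau> \<partial>cap_law e)) = 0"
      unfolding a by (simp add: algebra_simps)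
    with b show ?thesis by simp
  qed
  moreover have "(\<integral>\<tau>. \<tau> * \<psi> \<tau> \<partial>cap_law e) = (\<integral>\<tau>. u \<tau> \<partial>cap_law e)"
    "(\<integral>\<tau>. (1 - \<tau>\<^sup>2) * \<psi>' \<tau> \<partial>cap_law e) = (\<integral>\<tau>. v \<tau> \<partial>cap_law e)"
    by (rule integral_cong_AE, measurable, rule AE_mp[OF AE_cap_law[OF e]], simp add: u_def v_def c)+
  ultimately show ?thesis by simp
qed

section \<open>Means over spheres\<close>

lemma integrable_cap_law:
  fixes g :: "real \<Rightarrow> real"
  assumes e: "norm e = 1" and g: "continuous_on {-1..1} g" and [measurable]: "g \<in> borel_measurable borel"
  shows "integrable (cap_law e) g"
proof -
  interpret prob_space "cap_law e" by (rule prob_space_cap_law)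
  have "bounded (g ` {-1..1})"
    by (intro compact_imp_bounded compact_continuous_image g) auto
  then obtain B where B: "\<forall>x\<in>{-1..1}. \<bar>g x\<bar> \<le> B" unfolding bounded_iff by auto
  have "AE \<tau> in cap_law e. norm (g \<tau>) \<le> B"
    using AE_cap_law[OF e] by eventually_elim (use B in \<open>auto simp: abs_le_iff\<close>)
  then show ?thesis by (rule integrable_const_bound) simp
qed

lemma cap_law_mono:
  fixes g h :: "real \<Rightarrow> real"
  assumes e: "norm e = 1" and "integrable (cap_law e) g" "integrable (cap_law e) h"
    and "\<And>\<tau>. \<bar>\<tau>\<bar> \<le> 1 \<Longrightarrow> g \<tau> \<le> h \<tau>"
  shows "(\<integral>\<tau>. g \<tau> \<partial>cap_law e) \<le> (\<integral>\<tau>. h \<tau> \<partial>cap_law e)"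
  by (rule integral_mono_AE[OF assms(2,3)], use AE_cap_law[OF e] in eventually_elim) (rule assms(4))

text \<open>The derivative is continuous in both variables, hence bounded on the compact rectangle
  of radii within 1 of \<open>r\<close> and cosines in [-1, 1]; this bound dominates.\<close>

lemma cap_law_has_field_derivative:
  fixes g g' :: "real \<Rightarrow> real \<Rightarrow> real"
  assumes e: "norm e = 1"
    and g: "\<And>r. continuous_on UNIV (g r)"
    and der: "\<And>r \<tau>. \<bar>\<tau>\<bar> \<le> 1 \<Longrightarrow> ((\<lambda>r. g r \<tau>) has_field_derivative g' r \<tau>) (at r)"
    and g': "continuous_on UNIV (\<lambda>p. g' (fst p) (snd p))"
  shows "((\<lambda>r. \<integral>\<tau>. g r \<tau> \<partial>cap_law e) has_field_derivative (\<integral>\<tau>. g' r \<tau> \<partial>cap_law e)) (at r)"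
proof -
  interpret prob_space "cap_law e" by (rule prob_space_cap_law)
  have "bounded ((\<lambda>p. g' (fst p) (snd p)) ` ({r - 1..r + 1} \<times> {-1..1}))"
    by (intro compact_imp_bounded compact_continuous_image compact_Times continuous_on_subset[OF g']) auto
  then obtain B where B: "\<forall>x\<in>({r - 1..r + 1} \<times> {-1..1}). \<bar>g' (fst x) (snd x)\<bar> \<le> B"
    unfolding bounded_iff by auto
  have cont: "continuous_on UNIV (g' r)"
    using continuous_on_compose2[OF g', of UNIV "\<lambda>\<tau>. (r, \<tau>)"] by (simp add: continuous_intros)
  show ?thesis
  proof (rule has_field_derivative_integral[where A = "{\<tau>. \<bar>\<tau>\<bar> \<le> 1}" and w = "\<lambda>_. B"])
    show "AE \<tau> in cap_law e. \<tau> \<in> {\<tau>. \<bar>\<tau>\<bar> \<le> 1}" using AE_cap_law[OF e] by simp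
    show "\<bar>g' u \<tau>\<bar> \<le> B" if "\<bar>u - r\<bar> < 1" "\<tau> \<in> {\<tau>. \<bar>\<tau>\<bar> \<le> 1}" for u \<tau>
      using B[rule_format, of "(u, \<tau>)"] that by (auto simp: abs_less_iff abs_le_iff)
    show "integrable (cap_law e) (g u)" for u
      by (rule integrable_cap_law[OF e]) (auto intro: continuous_on_subset[OF g] borel_measurable_continuous_onI[OF g])
    show "g' r \<in> borel_measurable (cap_law e)"
      using borel_measurable_continuous_onI[OF cont] by simp
  qed (use der in auto)
qed

text \<open>For a unit vector \<open>e\<close> and \<open>\<theta> = q e\<close>, a point \<open>x = \<theta> + r u\<close> of the sphere of radius \<open>r\<close> around
  \<open>\<theta>\<close> has \<open>norm x ^ 2 = sqdist r q \<tau>\<close> and \<open>x \<bullet> (x - \<theta>) = r (r + q \<tau>)\<close>, where \<open>\<tau> = e \<bullet> u\<close>.\<close>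

definition sqdist :: "real \<Rightarrow> real \<Rightarrow> real \<Rightarrow> real" where
  "sqdist r q \<tau> = r\<^sup>2 + 2 * r * q * \<tau> + q\<^sup>2"

definition sphere_mean :: "'a::euclidean_space \<Rightarrow> (real \<Rightarrow> real) \<Rightarrow> real \<Rightarrow> real \<Rightarrow> real" where
  "sphere_mean e \<psi> r q = (\<integral>\<tau>. \<psi> (sqdist r q \<tau>) \<partial>cap_law e)"

text \<open>The mean over the sphere of the outward normal component of the field \<psi>(|x|^2) x.
  Up to a constant, its product with the power d - 1 of \<open>r\<close> is the flux of that field
  through the sphere.\<close>

definition sphere_flux :: "'a::euclidean_space \<Rightarrow> (real \<Rightarrow> real) \<Rightarrow> real \<Rightarrow> real \<Rightarrow> real" where
  "sphere_flux e \<psi> r q = (\<integral>\<tau>. (r + q * \<tau>) * \<psi> (sqdist r q \<tau>) \<partial>cap_law e)"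

lemma sqdist_ge: assumes "\<bar>\<tau>\<bar> \<le> 1" shows "(\<bar>r\<bar> - \<bar>q\<bar>)\<^sup>2 \<le> sqdist r q \<tau>"
proof -
  have "- (\<bar>r\<bar> * \<bar>q\<bar>) \<le> r * q * \<tau>"
    using mult_left_mono[OF assms, of "\<bar>r * q\<bar>"] by (simp add: abs_mult[symmetric] abs_le_iff)
  then show ?thesis by (simp add: sqdist_def power2_eq_square algebra_simps)
qed

lemma sqdist_le: assumes "\<bar>\<tau>\<bar> \<le> 1" shows "sqdist r q \<tau> \<le> (\<bar>r\<bar> + \<bar>q\<bar>)\<^sup>2"
proof -
  have "r * q * \<tau> \<le> \<bar>r\<bar> * \<bar>q\<bar>"
    using mult_left_mono[OF assms, of "\<bar>r * q\<bar>"] by (simp add: abs_mult[symmetric] abs_le_iff)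
  then show ?thesis by (simp add: sqdist_def power2_eq_square algebra_simps)
qed

lemma sqdist_nonneg: "\<bar>\<tau>\<bar> \<le> 1 \<Longrightarrow> 0 \<le> sqdist r q \<tau>"
  using sqdist_ge[of \<tau> r q] by (meson order_trans zero_le_power2)

lemma sqdist_commute: "sqdist r q = sqdist q r"
  by (auto simp: sqdist_def algebra_simps)

lemma continuous_on_sqdist [continuous_intros]:
  "continuous_on S f \<Longrightarrow> continuous_on S g \<Longrightarrow> continuous_on S h \<Longrightarrow> continuous_on S (\<lambda>x. sqdist (f x) (g x) (h x))"
  unfolding sqdist_def by (intro continuous_intros)

lemma sphere_mean_commute: "sphere_mean e \<psi> r q = sphere_mean e \<psi> q r"
  by (simp add: sphere_mean_def sqdist_commute)

lemma sphere_mean_zero: "sphere_mean e \<psi> r 0 = \<psi> (r\<^sup>2)"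
proof -
  interpret prob_space "cap_law e" by (rule prob_space_cap_law)
  show ?thesis by (simp add: sphere_mean_def sqdist_def prob_space[unfolded space_cap_law])
qed

section \<open>Derivatives of sphere means and fluxes in the radius\<close>

locale sphere_test =
  fixes e :: "'a::euclidean_space" and \<psi> \<psi>' :: "real \<Rightarrow> real"
  assumes e: "norm e = 1"
    and cont: "continuous_on UNIV \<psi>" "continuous_on UNIV \<psi>'"
    and der: "\<And>t. t \<ge> 0 \<Longrightarrow> (\<psi> has_field_derivative \<psi>' t) (at t)"
begin

lemma cont_compose:
  "continuous_on UNIV f \<Longrightarrow> continuous_on UNIV (\<lambda>x. \<psi> (f x))"
  "continuous_on UNIV f \<Longrightarrow> continuous_on UNIV (\<lambda>x. \<psi>' (f x))"
  using continuous_on_compose2[OF cont(1)] continuous_on_compose2[OF cont(2)] by auto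

lemma integrable:
  assumes "continuous_on UNIV g"
  shows "integrable (cap_law e) (\<lambda>\<tau>. g \<tau> * \<psi> (sqdist r q \<tau>))"
    "integrable (cap_law e) (\<lambda>\<tau>. g \<tau> * \<psi>' (sqdist r q \<tau>))"
    "integrable (cap_law e) (\<lambda>\<tau>. \<psi> (sqdist r q \<tau>))"
    "integrable (cap_law e) (\<lambda>\<tau>. \<psi>' (sqdist r q \<tau>))"
proof -
  have i: "integrable (cap_law e) h" if "continuous_on UNIV h" for h :: "real \<Rightarrow> real"
    by (rule integrable_cap_law[OF e continuous_on_subset[OF that subset_UNIV] borel_measurable_continuous_onI[OF that]])
  have c: "continuous_on UNIV (\<lambda>\<tau>. \<psi> (sqdist r q \<tau>))" "continuous_on UNIV (\<lambda>\<tau>. \<psi>' (sqdist r q \<tau>))"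
    by (intro cont_compose continuous_on_sqdist continuous_on_const continuous_on_id)+
  show "integrable (cap_law e) (\<lambda>\<tau>. g \<tau> * \<psi> (sqdist r q \<tau>))"
    "integrable (cap_law e) (\<lambda>\<tau>. g \<tau> * \<psi>' (sqdist r q \<tau>))"
    "integrable (cap_law e) (\<lambda>\<tau>. \<psi> (sqdist r q \<tau>))"
    "integrable (cap_law e) (\<lambda>\<tau>. \<psi>' (sqdist r q \<tau>))"
    by (rule i, intro continuous_on_mult assms c)+
qed

lemma der_sqdist:
  assumes "\<bar>\<tau>\<bar> \<le> 1"
  shows "((\<lambda>r. \<psi> (sqdist r q \<tau>)) has_field_derivative 2 * (r + q * \<tau>) * \<psi>' (sqdist r q \<tau>)) (at r)"
    and "((\<lambda>\<tau>. \<psi> (sqdist r q \<tau>)) has_field_derivative 2 * r * q * \<psi>' (sqdist r q \<tau>)) (at \<tau>)"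
proof -
  have 1: "((\<lambda>r. sqdist r q \<tau>) has_field_derivative 2 * (r + q * \<tau>)) (at r)"
    unfolding sqdist_def by (auto intro!: derivative_eq_intros)
  have 2: "((\<lambda>\<tau>. sqdist r q \<tau>) has_field_derivative 2 * r * q) (at \<tau>)"
    unfolding sqdist_def by (auto intro!: derivative_eq_intros)
  note d = der[OF sqdist_nonneg[OF assms]]
  show "((\<lambda>r. \<psi> (sqdist r q \<tau>)) has_field_derivative 2 * (r + q * \<tau>) * \<psi>' (sqdist r q \<tau>)) (at r)"
    using DERIV_chain2[OF d 1] by (simp add: mult.commute)
  show "((\<lambda>\<tau>. \<psi> (sqdist r q \<tau>)) has_field_derivative 2 * r * q * \<psi>' (sqdist r q \<tau>)) (at \<tau>)"
    using DERIV_chain2[OF d 2] by (simp add: mult.commute)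
qed

text \<open>The gradient of \<psi>(|x|^2) is 2 \<psi>'(|x|^2) x, and the mean changes at the rate of
  the mean normal derivative.\<close>

lemma sphere_mean_deriv:
  "((\<lambda>r. sphere_mean e \<psi> r q) has_field_derivative 2 * sphere_flux e \<psi>' r q) (at r)"
proof -
  have "((\<lambda>r. sphere_mean e \<psi> r q) has_field_derivative (\<integral>\<tau>. 2 * (r + q * \<tau>) * \<psi>' (sqdist r q \<tau>) \<partial>cap_law e)) (at r)"
    unfolding sphere_mean_def
  proof (rule cap_law_has_field_derivative[OF e _ der_sqdist(1)])
    show "continuous_on UNIV (\<lambda>p. 2 * (fst p + q * snd p) * \<psi>' (sqdist (fst p) q (snd p)))"
      by (intro continuous_intros cont_compose)
  qed (auto intro!: continuous_intros cont_compose)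
  then show ?thesis unfolding sphere_flux_def by (simp only: mult.assoc integral_mult_right_zero)
qed

text \<open>The divergence theorem, differentiated in the radius: the field \<psi>(|x|^2) x has
  divergence d \<psi> + 2 |x|^2 \<psi>', and the flux grows at the rate of its integral over the
  sphere.\<close>

lemma sphere_flux_deriv:
  assumes d2: "DIM('a) \<ge> 2"
  shows "((\<lambda>r. r ^ (DIM('a) - 1) * sphere_flux e \<psi> r q) has_field_derivative
     r ^ (DIM('a) - 1) * (\<integral>\<tau>. DIM('a) * \<psi> (sqdist r q \<tau>) + 2 * (sqdist r q \<tau> * \<psi>' (sqdist r q \<tau>)) \<partial>cap_law e)) (at r)"
  (is "(_ has_field_derivative _ * ?I) _")
proof -
  let ?d = "real DIM('a)"
  let ?p = "\<lambda>\<tau>. \<psi> (sqdist r q \<tau>)" and ?p' = "\<lambda>\<tau>. \<psi>' (sqdist r q \<tau>)"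
  have int: "integrable (cap_law e) (\<lambda>\<tau>. g \<tau> * ?p \<tau>)" "integrable (cap_law e) (\<lambda>\<tau>. g \<tau> * ?p' \<tau>)"
    if "continuous_on UNIV g" for g using integrable[OF that] by auto
  have 1: "((\<lambda>r. sphere_flux e \<psi> r q) has_field_derivative
      (\<integral>\<tau>. ?p \<tau> + 2 * (r + q * \<tau>)\<^sup>2 * ?p' \<tau> \<partial>cap_law e)) (at r)"
    unfolding sphere_flux_def
  proof (rule cap_law_has_field_derivative[OF e,
        where g' = "\<lambda>r \<tau>. \<psi> (sqdist r q \<tau>) + 2 * (r + q * \<tau>)\<^sup>2 * \<psi>' (sqdist r q \<tau>)"])
    fix u \<tau> :: real assume "\<bar>\<tau>\<bar> \<le> 1"
    then show "((\<lambda>r. (r + q * \<tau>) * \<psi> (sqdist r q \<tau>)) has_field_derivative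
       \<psi> (sqdist u q \<tau>) + 2 * (u + q * \<tau>)\<^sup>2 * \<psi>' (sqdist u q \<tau>)) (at u)"
      by (auto intro!: derivative_eq_intros der_sqdist simp: power2_eq_square algebra_simps)
  next
    show "continuous_on UNIV (\<lambda>p. \<psi> (sqdist (fst p) q (snd p)) + 2 * (fst p + q * snd p)\<^sup>2 * \<psi>' (sqdist (fst p) q (snd p)))"
      by (intro continuous_intros cont_compose)
  qed (intro continuous_intros cont_compose)
  \<comment> \<open>This supplies the tangential part of the divergence; differentiating under the
    mean in \<open>r\<close> has produced only the normal part.\<close>
  have ibp: "(?d - 1) * (\<integral>\<tau>. \<tau> * ?p \<tau> \<partial>cap_law e) = (\<integral>\<tau>. (1 - \<tau>\<^sup>2) * (2 * r * q * ?p' \<tau>) \<partial>cap_law e)"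
  proof (rule cap_law_integration_by_parts[OF e der_sqdist(2)])
    show "continuous_on {-1..1} (\<lambda>\<tau>. 2 * r * q * ?p' \<tau>)"
      by (rule continuous_on_subset[OF _ subset_UNIV]) (intro continuous_intros cont_compose)
  qed (auto intro!: borel_measurable_continuous_onI continuous_intros cont_compose)
  have "(?d - 1) * sphere_flux e \<psi> r q = (?d - 1) * (r * (\<integral>\<tau>. ?p \<tau> \<partial>cap_law e)) + q * ((?d - 1) * (\<integral>\<tau>. \<tau> * ?p \<tau> \<partial>cap_law e))"
  proof -
    have "sphere_flux e \<psi> r q = (\<integral>\<tau>. r * ?p \<tau> + q * (\<tau> * ?p \<tau>) \<partial>cap_law e)"
      by (simp add: sphere_flux_def algebra_simps)
    also have "\<dots> = r * (\<integral>\<tau>. ?p \<tau> \<partial>cap_law e) + q * (\<integral>\<tau>. \<tau> * ?p \<tau> \<partial>cap_law e)"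
      using int(1)[of "\<lambda>_. 1"] int(1)[of "\<lambda>\<tau>. \<tau>"]
      by (subst Bochner_Integration.integral_add) simp_all
    finally show ?thesis by (simp add: algebra_simps)
  qed
  also have "\<dots> = r * (\<integral>\<tau>. (?d - 1) * ?p \<tau> + 2 * q\<^sup>2 * ((1 - \<tau>\<^sup>2) * ?p' \<tau>) \<partial>cap_law e)"
  proof -
    have i: "integrable (cap_law e) (\<lambda>\<tau>. (1 - \<tau>\<^sup>2) * ?p' \<tau>)"
      by (intro int(2) continuous_intros)
    have k1: "(\<integral>\<tau>. (1 - \<tau>\<^sup>2) * (2 * r * q * ?p' \<tau>) \<partial>cap_law e) = 2 * r * q * (\<integral>\<tau>. (1 - \<tau>\<^sup>2) * ?p' \<tau> \<partial>cap_law e)"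
      by (simp only: mult.left_commute[of _ "2 * r * q"] integral_mult_right_zero)
    have k2: "(\<integral>\<tau>. (?d - 1) * ?p \<tau> + 2 * q\<^sup>2 * ((1 - \<tau>\<^sup>2) * ?p' \<tau>) \<partial>cap_law e)
        = (?d - 1) * (\<integral>\<tau>. ?p \<tau> \<partial>cap_law e) + 2 * q\<^sup>2 * (\<integral>\<tau>. (1 - \<tau>\<^sup>2) * ?p' \<tau> \<partial>cap_law e)"
      using i int(1)[of "\<lambda>_. 1"] by (subst Bochner_Integration.integral_add) simp_all
    show ?thesis unfolding ibp k1 k2 by algebra
  qed
  finally have 2: "(?d - 1) * sphere_flux e \<psi> r q = r * (\<integral>\<tau>. (?d - 1) * ?p \<tau> + 2 * q\<^sup>2 * ((1 - \<tau>\<^sup>2) * ?p' \<tau>) \<partial>cap_law e)" .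
  \<comment> \<open>Normal and tangential components of x combine by Pythagoras: \<open>(r + q *
    \<tau>)\<^sup>2 + q\<^sup>2 * (1 - \<tau>\<^sup>2) = sqdist r q \<tau>\<close>.\<close>
  have split: "?d * ?p \<tau> + 2 * (sqdist r q \<tau> * ?p' \<tau>)
      = (?p \<tau> + 2 * (r + q * \<tau>)\<^sup>2 * ?p' \<tau>) + ((?d - 1) * ?p \<tau> + 2 * q\<^sup>2 * ((1 - \<tau>\<^sup>2) * ?p' \<tau>))" for \<tau>
    by (simp add: sqdist_def power2_eq_square algebra_simps)
  have I: "?I = (\<integral>\<tau>. ?p \<tau> + 2 * (r + q * \<tau>)\<^sup>2 * ?p' \<tau> \<partial>cap_law e)
      + (\<integral>\<tau>. (?d - 1) * ?p \<tau> + 2 * q\<^sup>2 * ((1 - \<tau>\<^sup>2) * ?p' \<tau>) \<partial>cap_law e)" (is "_ = ?A + ?B")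
    unfolding split
  proof (rule Bochner_Integration.integral_add)
    show "integrable (cap_law e) (\<lambda>\<tau>. ?p \<tau> + 2 * (r + q * \<tau>)\<^sup>2 * ?p' \<tau>)"
      by (intro Bochner_Integration.integrable_add integrable(3)[OF continuous_on_id] int(2) continuous_intros)
    show "integrable (cap_law e) (\<lambda>\<tau>. (?d - 1) * ?p \<tau> + 2 * q\<^sup>2 * ((1 - \<tau>\<^sup>2) * ?p' \<tau>))"
      unfolding mult.assoc[symmetric]
      by (intro Bochner_Integration.integrable_add int(1) int(2) continuous_intros)
  qed
  have "((\<lambda>r. r ^ (DIM('a) - 1) * sphere_flux e \<psi> r q) has_field_derivative
     real (DIM('a) - 1) * r ^ (DIM('a) - 1 - 1) * sphere_flux e \<psi> r q + r ^ (DIM('a) - 1) * ?A) (at r)"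
    by (rule derivative_eq_intros 1 refl)+ (simp add: algebra_simps)
  moreover have "real (DIM('a) - 1) * r ^ (DIM('a) - 1 - 1) * sphere_flux e \<psi> r q = r ^ (DIM('a) - 1) * ?B"
  proof -
    have "DIM('a) - 1 = Suc (DIM('a) - 1 - 1)" using d2 by simp
    then have "r ^ (DIM('a) - 1) = r ^ (DIM('a) - 1 - 1) * r"
      by (metis power_Suc2)
    moreover have "real (DIM('a) - 1) = ?d - 1" using d2 by simp
    ultimately have "real (DIM('a) - 1) * r ^ (DIM('a) - 1 - 1) * sphere_flux e \<psi> r q
        = r ^ (DIM('a) - 1 - 1) * ((?d - 1) * sphere_flux e \<psi> r q)"
      by (simp only: mult_ac)
    also have "\<dots> = r ^ (DIM('a) - 1) * ?B"
      unfolding 2 \<open>r ^ (DIM('a) - 1) = r ^ (DIM('a) - 1 - 1) * r\<close> by (simp only: mult.assoc)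
    finally show ?thesis .
  qed
  ultimately show ?thesis unfolding I by (simp add: distrib_left add.commute)
qed

end


text \<open>The expression in \<open>superharmonic\<close> is half the Laplacian of \<phi>(|x|^2) at
  |x|^2 = t. The condition \<open>times_mono\<close> says that t \<phi>(t), which plays the part of
  s(t), has nonnegative derivative.\<close>

locale superharmonic_profile =
  fixes e :: "'a::euclidean_space" and \<phi> \<phi>' \<phi>'' :: "real \<Rightarrow> real"
  assumes e: "norm e = 1" and dim: "DIM('a) \<ge> 2"
    and cont: "continuous_on UNIV \<phi>" "continuous_on UNIV \<phi>'" "continuous_on UNIV \<phi>''"
    and der: "\<And>t. t \<ge> 0 \<Longrightarrow> (\<phi> has_field_derivative \<phi>' t) (at t)"
      "\<And>t. t \<ge> 0 \<Longrightarrow> (\<phi>' has_field_derivative \<phi>'' t) (at t)"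
    and superharmonic: "\<And>t. t \<ge> 0 \<Longrightarrow> DIM('a) * \<phi>' t + 2 * (t * \<phi>'' t) \<le> 0"
    and times_mono: "\<And>t. t \<ge> 0 \<Longrightarrow> 0 \<le> \<phi> t + t * \<phi>' t"
begin

sublocale P: sphere_test e \<phi> \<phi>'
  by standard (use e cont der in auto)

sublocale P': sphere_test e \<phi>' \<phi>''
  by standard (use e cont der in auto)

text \<open>By \<open>sphere_flux_deriv\<close> applied to \<open>\<phi>'\<close>, the rescaled flux
  of the gradient has the mean of half the Laplacian, up to a nonnegative factor, as its derivative;
  it starts from 0 at radius 0.\<close>

lemma flux_nonpos:
  assumes r: "r \<ge> 0"
  shows "r * sphere_flux e \<phi>' r q \<le> 0"
proof (cases "r = 0")
  case False
  with r have "r > 0" by simp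
  let ?f = "\<lambda>r. r ^ (DIM('a) - 1) * sphere_flux e \<phi>' r q"
    have "?f r \<le> ?f 0"
    proof (rule DERIV_nonpos_imp_nonincreasing[of 0 r ?f])
      fix u :: real assume u: "0 \<le> u" "u \<le> r"
      have "(\<integral>\<tau>. DIM('a) * \<phi>' (sqdist u q \<tau>) + 2 * (sqdist u q \<tau> * \<phi>'' (sqdist u q \<tau>)) \<partial>cap_law e) \<le> (\<integral>\<tau>. 0 \<partial>cap_law e)"
        by (rule cap_law_mono[OF e])
          (auto intro!: P'.integrable superharmonic sqdist_nonneg Bochner_Integration.integrable_add
             Bochner_Integration.integrable_mult_right continuous_on_sqdist continuous_on_const continuous_on_id)
      then have "u ^ (DIM('a) - 1) * (\<integral>\<tau>. DIM('a) * \<phi>' (sqdist u q \<tau>) + 2 * (sqdist u q \<tau> * \<phi>'' (sqdist u q \<tau>)) \<partial>cap_law e) \<le> 0"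
        using u by (intro mult_nonneg_nonpos) auto
      then show "\<exists>y. (?f has_real_derivative y) (at u) \<and> y \<le> 0"
        using P'.sphere_flux_deriv[OF dim, of q u] by blast
    qed (use r in simp)
    also have "?f 0 = 0" using dim by simp
    finally have "\<not> 0 < sphere_flux e \<phi>' r q"
      using mult_pos_pos[OF zero_less_power[OF \<open>r > 0\<close>]] by (simp add: not_less) (meson not_less)
    then show ?thesis using \<open>r > 0\<close> by (simp add: mult_le_0_iff)
qed simp

lemma sphere_mean_antimono:
  assumes "0 \<le> r" "r \<le> r'" shows "sphere_mean e \<phi> r' q \<le> sphere_mean e \<phi> r q"
proof (rule DERIV_nonpos_imp_decreasing_open[OF assms(2)])
  fix u assume "r < u" "u < r'"
  moreover from this have "sphere_flux e \<phi>' u q \<le> 0"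
    using flux_nonpos[of u q] assms by (simp add: mult_le_0_iff)
  ultimately show "\<exists>y. ((\<lambda>r. sphere_mean e \<phi> r q) has_real_derivative y) (at u) \<and> y \<le> 0"
    using P.sphere_mean_deriv[of q u] by fastforce
qed (rule DERIV_continuous_on, rule DERIV_subset[OF P.sphere_mean_deriv], simp)

text \<open>Since \<open>r\<close> and \<open>q\<close> can be exchanged, this is the mean value
  inequality on the sphere of radius \<open>q\<close> around a point at distance \<open>r\<close>
  from the origin.\<close>

lemma sphere_mean_le:
  assumes "0 \<le> q" shows "sphere_mean e \<phi> r q \<le> \<phi> (r\<^sup>2)"
  using sphere_mean_antimono[of 0 q r] assms
  by (simp add: sphere_mean_commute[of e \<phi> r q] sphere_mean_commute[of e \<phi> 0 r] sphere_mean_zero)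

text \<open>The difference \<open>?f\<close> vanishes at radius 0 and is nondecreasing. By
  \<open>times_mono\<close> the divergence is at least d - 2 times \<phi>, while the d-th power of
  the radius times the mean grows by at most d times the power d - 1 times the mean, because the
  flux of the gradient is nonpositive. The factor (d - 2) / d balances the two rates.\<close>

lemma flux_ge_mean:
  assumes r: "r > 0"
  shows "(real DIM('a) - 2) / DIM('a) * r * sphere_mean e \<phi> r q \<le> sphere_flux e \<phi> r q"
proof -
  define d where "d = real DIM('a)"
  let ?n = "DIM('a) - 1"
  have d: "d > 0" "d \<ge> 2" "real DIM('a) = d" using dim by (auto simp: d_def)
  let ?f = "\<lambda>r. r ^ ?n * sphere_flux e \<phi> r q - (d - 2) / d * (r ^ DIM('a) * sphere_mean e \<phi> r q)"
  have "?f 0 \<le> ?f r"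
  proof (rule DERIV_nonneg_imp_nondecreasing[of 0 r ?f])
    fix u :: real assume u: "0 \<le> u" "u \<le> r"
    let ?I = "\<integral>\<tau>. DIM('a) * \<phi> (sqdist u q \<tau>) + 2 * (sqdist u q \<tau> * \<phi>' (sqdist u q \<tau>)) \<partial>cap_law e"
    have "((\<lambda>r. r ^ DIM('a) * sphere_mean e \<phi> r q) has_real_derivative
        real DIM('a) * u ^ ?n * sphere_mean e \<phi> u q + u ^ DIM('a) * (2 * sphere_flux e \<phi>' u q)) (at u)"
      using P.sphere_mean_deriv[of q u] by (auto intro!: derivative_eq_intros)
    from DERIV_diff[OF P.sphere_flux_deriv[OF dim, of q u] DERIV_cmult[OF this, of "(d - 2) / d"]]
    have "(?f has_real_derivative
       u ^ ?n * ?I - (d - 2) / d * (real DIM('a) * u ^ ?n * sphere_mean e \<phi> u q + u ^ DIM('a) * (2 * sphere_flux e \<phi>' u q))) (at u)" .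
    moreover have "(d - 2) * sphere_mean e \<phi> u q \<le> ?I"
    proof -
      have "(\<integral>\<tau>. (d - 2) * \<phi> (sqdist u q \<tau>) \<partial>cap_law e) \<le> ?I"
      proof (rule cap_law_mono[OF e])
        fix \<tau> :: real assume "\<bar>\<tau>\<bar> \<le> 1"
        from times_mono[OF sqdist_nonneg[OF this, of u q]]
        show "(d - 2) * \<phi> (sqdist u q \<tau>) \<le> DIM('a) * \<phi> (sqdist u q \<tau>) + 2 * (sqdist u q \<tau> * \<phi>' (sqdist u q \<tau>))"
          unfolding d(3) by (simp add: algebra_simps)
      qed (auto intro!: P.integrable Bochner_Integration.integrable_add
             Bochner_Integration.integrable_mult_right continuous_on_sqdist continuous_on_const continuous_on_id)
      then show ?thesis by (simp add: sphere_mean_def)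
    qed
    then have "u ^ ?n * ((d - 2) * sphere_mean e \<phi> u q) \<le> u ^ ?n * ?I"
      using u by (intro mult_left_mono) auto
    moreover have "(d - 2) / d * (u ^ DIM('a) * (2 * sphere_flux e \<phi>' u q)) \<le> 0"
    proof -
      have "u ^ DIM('a) = u ^ ?n * u" using dim by (metis DIM_positive power_minus_mult)
      then have "(d - 2) / d * (u ^ DIM('a) * (2 * sphere_flux e \<phi>' u q)) = ((d - 2) / d * u ^ ?n * 2) * (u * sphere_flux e \<phi>' u q)"
        by simp
      also have "\<dots> \<le> 0"
        by (rule mult_nonneg_nonpos[OF _ flux_nonpos[OF u(1)]]) (use u d in auto)
      finally show ?thesis .
    qed
    moreover have "(d - 2) / d * (real DIM('a) * u ^ ?n * sphere_mean e \<phi> u q + u ^ DIM('a) * (2 * sphere_flux e \<phi>' u q))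
       = u ^ ?n * ((d - 2) * sphere_mean e \<phi> u q) + (d - 2) / d * (u ^ DIM('a) * (2 * sphere_flux e \<phi>' u q))"
      unfolding d(3) using d by (simp add: field_simps)
    ultimately show "\<exists>y. (?f has_real_derivative y) (at u) \<and> 0 \<le> y"
      by (intro exI conjI) (assumption, linarith)
  qed (use r in simp)
  moreover have "?f 0 = 0" using dim by (simp add: power_0_left)
  moreover have "r ^ DIM('a) = r ^ ?n * r" using dim by (metis DIM_positive power_minus_mult)
  ultimately have "0 \<le> r ^ ?n * (sphere_flux e \<phi> r q - (d - 2) / d * r * sphere_mean e \<phi> r q)"
    by (simp only: right_diff_distrib mult_ac)
  then have "\<not> sphere_flux e \<phi> r q - (d - 2) / d * r * sphere_mean e \<phi> r q < 0"
    using mult_pos_neg[OF zero_less_power[OF r]] by (meson not_less)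
  then show ?thesis unfolding d(3) by simp
qed

text \<open>Up to the factor \<open>2 * u\<close> the derivative is the mean plus \<open>u\<close>
  times the flux of \<open>\<phi>'\<close>. Because u (u + q \<tau>) + q (q + u \<tau>) =
  \<open>sqdist u q \<tau>\<close>, adding \<open>q\<close> times the flux with \<open>u\<close> and
  \<open>q\<close> exchanged gives the mean of \<phi>(t) + t \<phi>'(t), which is nonnegative; the
  added term is nonpositive by \<open>flux_nonpos\<close>.\<close>

lemma sq_times_sphere_mean_mono:
  assumes q: "q \<ge> 0" and r: "0 \<le> r" "r \<le> r'"
  shows "r\<^sup>2 * sphere_mean e \<phi> r q \<le> r'\<^sup>2 * sphere_mean e \<phi> r' q"
proof (rule DERIV_nonneg_imp_nondecreasing[OF r(2), of "\<lambda>r. r\<^sup>2 * sphere_mean e \<phi> r q"])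
  fix u assume "r \<le> u" "u \<le> r'"
  then have u: "u \<ge> 0" using r by simp
  have "((\<lambda>r. r\<^sup>2 * sphere_mean e \<phi> r q) has_real_derivative
      2 * u * (sphere_mean e \<phi> u q + u * sphere_flux e \<phi>' u q)) (at u)"
    using P.sphere_mean_deriv[of q u] by (auto intro!: derivative_eq_intros simp: algebra_simps power2_eq_square)
  moreover have "0 \<le> sphere_mean e \<phi> u q + u * sphere_flux e \<phi>' u q"
  proof -
    have "- (q * sphere_flux e \<phi>' q u) = (\<integral>\<tau>. - (q * ((q + u * \<tau>) * \<phi>' (sqdist u q \<tau>))) \<partial>cap_law e)"
      unfolding sphere_flux_def sqdist_commute[of q u] by simp
    also have "\<dots> \<le> (\<integral>\<tau>. \<phi> (sqdist u q \<tau>) + u * ((u + q * \<tau>) * \<phi>' (sqdist u q \<tau>)) \<partial>cap_law e)"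
    proof (rule cap_law_mono[OF e])
      fix \<tau> :: real assume "\<bar>\<tau>\<bar> \<le> 1"
      from times_mono[OF sqdist_nonneg[OF this, of u q]]
      show "- (q * ((q + u * \<tau>) * \<phi>' (sqdist u q \<tau>))) \<le> \<phi> (sqdist u q \<tau>) + u * ((u + q * \<tau>) * \<phi>' (sqdist u q \<tau>))"
        by (simp add: sqdist_def algebra_simps power2_eq_square)
    qed (auto intro!: P.integrable Bochner_Integration.integrable_add Bochner_Integration.integrable_minus
           Bochner_Integration.integrable_mult_right continuous_intros)
    also have "\<dots> = sphere_mean e \<phi> u q + u * sphere_flux e \<phi>' u q"
      unfolding sphere_mean_def sphere_flux_def
      by (subst Bochner_Integration.integral_add)
        (auto intro!: P.integrable Bochner_Integration.integrable_mult_right continuous_intros simp del: mult_eq_0_iff)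
    finally have "- (q * sphere_flux e \<phi>' q u) \<le> sphere_mean e \<phi> u q + u * sphere_flux e \<phi>' u q" .
    moreover have "q * sphere_flux e \<phi>' q u \<le> 0"
      by (rule flux_nonpos[OF q])
    ultimately show ?thesis by linarith
  qed
  ultimately show "\<exists>y. ((\<lambda>r. r\<^sup>2 * sphere_mean e \<phi> r q) has_real_derivative y) (at u) \<and> 0 \<le> y"
    using u by (intro exI conjI) (assumption, simp)
qed

end

section \<open>Concave profiles\<close>

lemma ex_antiderivative_pos:
  fixes f :: "real \<Rightarrow> real"
  assumes "continuous_on {0<..} f"
  obtains F where "\<And>t. t > 0 \<Longrightarrow> (F has_field_derivative f t) (at t)"
proof
  fix t :: real assume t: "t > 0"
  \<comment> \<open>The interval must contain the base point 1 of the integral, have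
    \<open>t\<close> in its interior and stay away from 0.\<close>
  define a b where "a = min t 1 / 2" and "b = max t 1 + 1"
  have ab: "a \<le> 1" "1 \<le> b" "a < t" "t < b" "a > 0" using t by (auto simp: a_def b_def)
  have "((\<lambda>u. LBINT y=ereal 1..ereal u. f y) has_vector_derivative f t) (at t within {a..b})"
    by (rule interval_integral_FTC2) (use ab in \<open>auto intro: continuous_on_subset[OF assms]\<close>)
  then have "((\<lambda>u. LBINT y=ereal 1..ereal u. f y) has_field_derivative f t) (at t within {a..b})"
    by (simp add: has_real_derivative_iff_has_vector_derivative)
  then show "((\<lambda>u. LBINT y=ereal 1..ereal u. f y) has_field_derivative f t) (at t)"
    using at_within_Icc_at[OF ab(3,4)] by simp
qed

locale concave_profile =
  fixes s :: "real \<Rightarrow> real"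
  assumes s01: "\<And>t. t \<ge> 0 \<Longrightarrow> 0 \<le> s t" "\<And>t. t \<ge> 0 \<Longrightarrow> s t \<le> 1"
    and s_mono: "\<And>t u. 0 \<le> t \<Longrightarrow> t \<le> u \<Longrightarrow> s t \<le> s u"
    and s_concave: "concave_on {0..} s"
    and s_meas [measurable]: "s \<in> borel_measurable borel"
begin

text \<open>A concave function on the closed half-line may jump upward at 0, so continuity is
  available only on the open half-line.\<close>

lemma continuous_s: "continuous_on {0<..} s"
proof -
  have "convex_on {0<..} (\<lambda>x. - s x)"
    using s_concave unfolding concave_on_def by (rule convex_on_subset) auto
  from continuous_on_minus[OF convex_on_continuous[OF _ this]] show ?thesis by simp
qed

text \<open>The smoothing is the second forward difference quotient of a twofold antiderivative of
  \<open>s\<close>, that is, an average of \<open>s\<close> over (t, t + 2 \<epsilon>). Its first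
  derivative inherits a sign from monotonicity, and its second derivative is the second difference
  quotient of \<open>s\<close> itself, nonpositive by midpoint concavity. Forward differences keep
  all arguments positive.\<close>

lemma ex_smoothing:
  assumes \<epsilon>: "\<epsilon> > 0"
  obtains \<sigma> \<sigma>' \<sigma>'' where
    "\<And>t. t > 0 \<Longrightarrow> (\<sigma> has_field_derivative \<sigma>' t) (at t)"
    "\<And>t. t > 0 \<Longrightarrow> (\<sigma>' has_field_derivative \<sigma>'' t) (at t)"
    "continuous_on {0<..} \<sigma>''"
    "\<And>t. t > 0 \<Longrightarrow> s t \<le> \<sigma> t" "\<And>t. t > 0 \<Longrightarrow> \<sigma> t \<le> s (t + 2 * \<epsilon>)"
    "\<And>t. t > 0 \<Longrightarrow> 0 \<le> \<sigma>' t" "\<And>t. t > 0 \<Longrightarrow> \<sigma>'' t \<le> 0"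
proof -
  obtain P where P: "\<And>t. t > 0 \<Longrightarrow> (P has_field_derivative s t) (at t)"
    using ex_antiderivative_pos[OF continuous_s] by blast
  have "continuous_on {0<..} P" by (rule DERIV_continuous_on, rule DERIV_subset[OF P]) auto
  then obtain Q where Q: "\<And>t. t > 0 \<Longrightarrow> (Q has_field_derivative P t) (at t)"
    using ex_antiderivative_pos by blast
  define D where "D g t = (g (t + 2 * \<epsilon>) - 2 * g (t + \<epsilon>) + g t) / \<epsilon>\<^sup>2" for g :: "real \<Rightarrow> real" and t
  have shift: "((\<lambda>t. g (t + c)) has_field_derivative g' (t + c)) (at t)"
    if "\<And>t. t > 0 \<Longrightarrow> (g has_field_derivative g' t) (at t)" "t > 0" "c \<ge> 0" for g g' :: "real \<Rightarrow> real" and t c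
    using that(2,3) by (intro DERIV_shift[THEN iffD1] that(1)) auto
  have D: "(D g has_field_derivative D g' t) (at t)"
    if "\<And>t. t > 0 \<Longrightarrow> (g has_field_derivative g' t) (at t)" "t > 0" for g g' t
    unfolding D_def using \<epsilon> that shift[OF that, of "2 * \<epsilon>"] shift[OF that, of \<epsilon>]
    by (auto intro!: derivative_eq_intros simp: field_simps)
  have mvt: "\<exists>\<xi>. t < \<xi> \<and> \<xi> < t + \<epsilon> \<and> g (t + \<epsilon>) - g t = \<epsilon> * g' \<xi>"
    if "\<And>t. t > 0 \<Longrightarrow> (g has_field_derivative g' t) (at t)" "t > 0" for g g' :: "real \<Rightarrow> real" and t
    using MVT2[of t "t + \<epsilon>" g g'] that \<epsilon> by auto
  have D2: "D g t = ((g (t + \<epsilon> + \<epsilon>) - g (t + \<epsilon>)) - (g (t + \<epsilon>) - g t)) / \<epsilon>\<^sup>2" for g t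
    by (simp add: D_def algebra_simps)
  have diff: "((\<lambda>t. g (t + \<epsilon>) - g t) has_field_derivative g' (t + \<epsilon>) - g' t) (at t)"
    if "\<And>t. t > 0 \<Longrightarrow> (g has_field_derivative g' t) (at t)" "t > 0" for g g' :: "real \<Rightarrow> real" and t
    by (intro DERIV_diff shift[OF that(1)] that) (use \<epsilon> in auto)
  \<comment> \<open>One use of the mean value theorem for each of the two differences.\<close>
  have between: "\<exists>\<xi>. t < \<xi> \<and> \<xi> < t + 2 * \<epsilon> \<and> D Q t = s \<xi>" if t: "t > 0" for t
  proof -
    obtain x where x: "t < x" "x < t + \<epsilon>"
      and 1: "(Q (t + \<epsilon> + \<epsilon>) - Q (t + \<epsilon>)) - (Q (t + \<epsilon>) - Q t) = \<epsilon> * (P (x + \<epsilon>) - P x)"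
      using mvt[OF diff[OF Q] t] by blast
    obtain y where y: "x < y" "y < x + \<epsilon>" and 2: "P (x + \<epsilon>) - P x = \<epsilon> * s y"
      using mvt[OF P, of x] x t by auto
    have "D Q t = s y" unfolding D2 1 2 using \<epsilon> by (simp add: power2_eq_square)
    then show ?thesis using x y by (intro exI[of _ y]) auto
  qed
  show ?thesis
  proof (rule that)
    show "(D Q has_field_derivative D P t) (at t)" "(D P has_field_derivative D s t) (at t)" if "t > 0" for t
      by (rule D; use Q P that in blast)+
    have "continuous_on {0<..} (\<lambda>t. s (t + c))" if "c \<ge> 0" for c
      by (rule continuous_on_compose2[OF continuous_s]) (use that in \<open>auto intro!: continuous_intros\<close>)
    then show "continuous_on {0<..} (D s)"
      unfolding D_def using \<epsilon> continuous_s by (intro continuous_intros) auto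
    fix t :: real assume t: "t > 0"
    obtain \<xi> where \<xi>: "t < \<xi>" "\<xi> < t + 2 * \<epsilon>" "D Q t = s \<xi>" using between[OF t] by blast
    show "s t \<le> D Q t" "D Q t \<le> s (t + 2 * \<epsilon>)" using \<xi> t by (auto intro!: s_mono)
    obtain x where x: "t < x" "x < t + \<epsilon>"
      and 1: "(P (t + \<epsilon> + \<epsilon>) - P (t + \<epsilon>)) - (P (t + \<epsilon>) - P t) = \<epsilon> * (s (x + \<epsilon>) - s x)"
      using mvt[OF diff[OF P] t] by blast
    show "0 \<le> D P t" unfolding D2 1 using \<epsilon> s_mono[of x "x + \<epsilon>"] x t by auto
    have "(1 - 1/2) * s t + 1/2 * s (t + 2 * \<epsilon>) \<le> s ((1 - 1/2) *\<^sub>R t + (1/2) *\<^sub>R (t + 2 * \<epsilon>))"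
      by (rule concave_onD[OF s_concave]) (use t \<epsilon> in auto)
    also have "(1 - 1/2) *\<^sub>R t + (1/2) *\<^sub>R (t + 2 * \<epsilon>) = t + \<epsilon>" by (simp add: field_simps)
    finally have "s (t + 2 * \<epsilon>) - 2 * s (t + \<epsilon>) + s t \<le> 0" by simp
    then show "D s t \<le> 0" unfolding D_def by (simp add: divide_nonpos_nonneg)
  qed
qed

text \<open>The shift by \<open>\<epsilon>\<close> in the quotient
  \<open>\<sigma> (t + \<epsilon>) / (t + \<epsilon>)\<close> removes the singularity at 0. The
  argument \<open>t + 3 * \<epsilon>\<close> in the upper bound adds the width
  \<open>2 * \<epsilon>\<close> of the smoothing to this shift.\<close>

lemma ex_superharmonic_approximation:
  fixes e :: "'a::euclidean_space"
  assumes e: "norm e = 1" and dim: "DIM('a) \<ge> 4" and \<epsilon>: "\<epsilon> > 0"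
  obtains \<phi> \<phi>' \<phi>'' where "superharmonic_profile e \<phi> \<phi>' \<phi>''"
    "\<And>t. t \<ge> 0 \<Longrightarrow> s (t + \<epsilon>) / (t + \<epsilon>) \<le> \<phi> t" "\<And>t. t \<ge> 0 \<Longrightarrow> \<phi> t \<le> s (t + 3 * \<epsilon>) / (t + \<epsilon>)"
proof -
  obtain \<sigma> \<sigma>' \<sigma>'' where
    d: "\<And>t. t > 0 \<Longrightarrow> (\<sigma> has_field_derivative \<sigma>' t) (at t)"
      "\<And>t. t > 0 \<Longrightarrow> (\<sigma>' has_field_derivative \<sigma>'' t) (at t)"
    and c'': "continuous_on {0<..} \<sigma>''"
    and s: "\<And>t. t > 0 \<Longrightarrow> s t \<le> \<sigma> t" "\<And>t. t > 0 \<Longrightarrow> \<sigma> t \<le> s (t + 2 * \<epsilon>)"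
    and sgn: "\<And>t. t > 0 \<Longrightarrow> 0 \<le> \<sigma>' t" "\<And>t. t > 0 \<Longrightarrow> \<sigma>'' t \<le> 0"
    using ex_smoothing[OF \<epsilon>] by blast
  have c: "continuous_on {0<..} \<sigma>" "continuous_on {0<..} \<sigma>'"
    by (rule DERIV_continuous_on, rule DERIV_subset[OF d(1)], auto,
        rule DERIV_continuous_on, rule DERIV_subset[OF d(2)], auto)
  have \<sigma>0: "0 \<le> \<sigma> t" if "t > 0" for t using s(1)[OF that] s01(1)[of t] that by simp
  \<comment> \<open>By concavity the tangent at \<open>t\<close> has a nonnegative intercept at 0.
    As \<open>\<sigma>\<close> is controlled only at positive arguments, the mean value theorem is
    used on [(1 - z) t, t] for every z < 1.\<close>
  have tangent: "t * \<sigma>' t \<le> \<sigma> t" if t: "t > 0" for t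
  proof (rule field_le_mult_one_interval)
    fix z :: real assume z: "0 < z" "z < 1"
    define u where "u = (1 - z) * t"
    have u: "0 < u" "u < t" using z t by (simp_all add: u_def)
    obtain x where x: "u < x" "x < t" "\<sigma> t - \<sigma> u = (t - u) * \<sigma>' x"
      using MVT2[OF u(2), of \<sigma> \<sigma>'] d(1) u by force
    have "\<sigma>' t \<le> \<sigma>' x"
    proof (rule DERIV_nonpos_imp_nonincreasing[of x t \<sigma>'])
      show "\<exists>y. (\<sigma>' has_real_derivative y) (at v) \<and> y \<le> 0" if "x \<le> v" "v \<le> t" for v
        using d(2)[of v] sgn(2)[of v] that x u by force
    qed (use x in simp)
    then have "(t - u) * \<sigma>' t \<le> (t - u) * \<sigma>' x" using u by (intro mult_left_mono) auto
    then have "(t - u) * \<sigma>' t \<le> \<sigma> t" using x(3) \<sigma>0[OF u(1)] by linarith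
    then show "z * (t * \<sigma>' t) \<le> \<sigma> t" by (simp add: u_def algebra_simps)
  qed
  \<comment> \<open>A positive continuous extension of \<open>t + \<epsilon>\<close> to the whole
    line. It agrees with \<open>t + \<epsilon>\<close> for t above -\<epsilon> / 2, so the
    derivative at 0 is two-sided.\<close>
  define u where "u t = max (\<epsilon> / 2) (t + \<epsilon>)" for t
  have u0: "u t > 0" for t using \<epsilon> by (simp add: u_def less_max_iff_disj)
  have cu: "continuous_on UNIV u" unfolding u_def by (intro continuous_intros)
  have u: "u t = t + \<epsilon>" if "t \<ge> 0" for t using \<epsilon> that by (simp add: u_def max_def)
  have du: "(u has_field_derivative 1) (at t)" if "t \<ge> 0" for t
    by (rule has_field_derivative_transform_within_open[where f = "\<lambda>t. t + \<epsilon>" and S = "{- \<epsilon> / 2<..}"])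
       (use \<epsilon> that in \<open>auto intro!: derivative_eq_intros simp: u_def max_def\<close>)
  define \<phi> where "\<phi> = (\<lambda>t. \<sigma> (u t) / u t)"
  define \<phi>' where "\<phi>' = (\<lambda>t. \<sigma>' (u t) / u t - \<sigma> (u t) / (u t)\<^sup>2)"
  define \<phi>'' where "\<phi>'' = (\<lambda>t. \<sigma>'' (u t) / u t - 2 * \<sigma>' (u t) / (u t)\<^sup>2 + 2 * \<sigma> (u t) / (u t) ^ 3)"
  have cc: "continuous_on UNIV (\<lambda>t. g (u t))" if "continuous_on {0<..} g" for g
    by (rule continuous_on_compose2[OF that cu]) (use u0 in auto)
  have nz: "u t \<noteq> 0" for t using u0[of t] by simp
  show ?thesis
  proof (rule that)
    show "superharmonic_profile e \<phi> \<phi>' \<phi>''"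
    proof
      show "continuous_on UNIV \<phi>" "continuous_on UNIV \<phi>'" "continuous_on UNIV \<phi>''"
        unfolding \<phi>_def \<phi>'_def \<phi>''_def
        by (intro continuous_intros cc c c'' cu; simp add: nz)+
      fix t :: real assume t: "t \<ge> 0"
      have D: "((\<lambda>t. \<sigma> (u t)) has_field_derivative \<sigma>' (u t)) (at t)"
        "((\<lambda>t. \<sigma>' (u t)) has_field_derivative \<sigma>'' (u t)) (at t)"
        using DERIV_chain2[OF d(1)[OF u0] du[OF t]] DERIV_chain2[OF d(2)[OF u0] du[OF t]] by simp_all
      show "(\<phi> has_field_derivative \<phi>' t) (at t)"
        unfolding \<phi>_def \<phi>'_def using nz[of t]
        by (auto intro!: derivative_eq_intros D du t simp: field_simps power2_eq_square)
      show "(\<phi>' has_field_derivative \<phi>'' t) (at t)"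
        unfolding \<phi>'_def \<phi>''_def using nz[of t]
        by (auto intro!: derivative_eq_intros D du t simp: field_simps power2_eq_square power3_eq_cube)
      define w where "w = u t"
      have w: "w > 0" "t \<le> w" using u[OF t] \<epsilon> t by (auto simp: w_def)
      have "0 \<le> (w - t) * \<sigma> w / w\<^sup>2 + t * \<sigma>' w / w"
        using w t \<sigma>0[OF w(1)] sgn(1)[OF w(1)] by simp
      also have "\<dots> = \<phi> t + t * \<phi>' t"
        unfolding \<phi>_def \<phi>'_def w_def[symmetric] using w by (simp add: field_simps power2_eq_square)
      finally show "0 \<le> \<phi> t + t * \<phi>' t" .
      \<comment> \<open>Here \<open>k\<close> is \<open>- \<phi>' t\<close>, and
        \<open>\<phi>'' t\<close> equals \<open>\<sigma>'' w / w + 2 * k / w\<close>. As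
        \<open>t / w \<le> 1\<close>, the terms in \<open>k\<close> total at most (4 - d)
        \<open>k\<close>, and this is where dimension 4 enters.\<close>
      define k where "k = (\<sigma> w - w * \<sigma>' w) / w\<^sup>2"
      have k: "k \<ge> 0" using tangent[OF w(1)] w by (simp add: k_def)
      have "DIM('a) * \<phi>' t + 2 * (t * \<phi>'' t) = - (DIM('a) * k) + 2 * t * \<sigma>'' w / w + 4 * (t / w * k)"
        unfolding \<phi>'_def \<phi>''_def w_def[symmetric] k_def using w
        by (simp add: field_simps power2_eq_square power3_eq_cube)
      also have "\<dots> \<le> - (4 * k) + 0 + 4 * (1 * k)"
        using dim w t k sgn(2)[OF w(1)]
        by (intro add_mono le_imp_neg_le mult_right_mono mult_left_mono divide_nonpos_pos mult_nonneg_nonpos) auto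
      finally show "DIM('a) * \<phi>' t + 2 * (t * \<phi>'' t) \<le> 0" by simp
    qed (use e dim in auto)
    fix t :: real assume t: "t \<ge> 0"
    show "s (t + \<epsilon>) / (t + \<epsilon>) \<le> \<phi> t" "\<phi> t \<le> s (t + 3 * \<epsilon>) / (t + \<epsilon>)"
      unfolding \<phi>_def u[OF t] using s(1)[of "t + \<epsilon>"] s(2)[of "t + \<epsilon>"] t \<epsilon>
      by (auto intro!: divide_right_mono simp: algebra_simps)
  qed
qed

text \<open>The inequalities for smooth profiles pass to the limit. For \<open>r \<noteq> q\<close>
  the sphere keeps distance \<open>\<bar>r - q\<bar>\<close> from the origin, so all approximations
  are bounded there by \<open>1 / (r - q)\<^sup>2\<close> and dominated convergence applies.\<close>

lemma sphere_inequalities: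
  fixes e :: "'a::euclidean_space"
  assumes e: "norm e = 1" and dim: "DIM('a) \<ge> 4" and q: "q \<ge> 0"
  defines "h \<equiv> \<lambda>t. s t / t"
  shows flux_ge: "r > 0 \<Longrightarrow> r \<noteq> q \<Longrightarrow> (real DIM('a) - 2) / DIM('a) * r * sphere_mean e h r q \<le> sphere_flux e h r q"
    and sq_mean_mono: "0 < r \<Longrightarrow> r \<le> r' \<Longrightarrow> r \<noteq> q \<Longrightarrow> r' \<noteq> q \<Longrightarrow>
      r\<^sup>2 * sphere_mean e h r q \<le> r'\<^sup>2 * sphere_mean e h r' q"
    and sq_mean_le_1: "r > 0 \<Longrightarrow> r \<noteq> q \<Longrightarrow> r\<^sup>2 * sphere_mean e h r q \<le> 1"
proof -
  interpret C: prob_space "cap_law e" by (rule prob_space_cap_law)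
  define \<epsilon> where "\<epsilon> n = inverse (real (Suc n))" for n
  have \<epsilon>: "\<epsilon> n > 0" for n by (simp add: \<epsilon>_def)
  have \<epsilon>0: "\<epsilon> \<longlonglongrightarrow> 0" unfolding \<epsilon>_def by (rule LIMSEQ_inverse_real_of_nat)
  have "\<exists>\<phi> \<phi>' \<phi>''. superharmonic_profile e \<phi> \<phi>' \<phi>'' \<and>
     (\<forall>t\<ge>0. s (t + \<epsilon> n) / (t + \<epsilon> n) \<le> \<phi> t \<and> \<phi> t \<le> s (t + 3 * \<epsilon> n) / (t + \<epsilon> n))" for n
    using ex_superharmonic_approximation[OF e dim \<epsilon>] by metis
  then obtain \<phi> \<phi>' \<phi>'' where \<phi>: "\<And>n. superharmonic_profile e (\<phi> n) (\<phi>' n) (\<phi>'' n)"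
    and b: "\<And>n t. t \<ge> 0 \<Longrightarrow> s (t + \<epsilon> n) / (t + \<epsilon> n) \<le> \<phi> n t" "\<And>n t. t \<ge> 0 \<Longrightarrow> \<phi> n t \<le> s (t + 3 * \<epsilon> n) / (t + \<epsilon> n)"
    by metis
  have [measurable]: "\<phi> n \<in> borel_measurable borel" for n
    using superharmonic_profile.cont(1)[OF \<phi>] by (rule borel_measurable_continuous_onI)
  have [measurable]: "h \<in> borel_measurable borel" unfolding h_def by measurable
  have [measurable]: "sqdist r q \<in> borel_measurable borel" for r
    unfolding sqdist_def[abs_def] by measurable
  have \<phi>0: "0 \<le> \<phi> n t" if "t \<ge> 0" for n t
    using b(1)[OF that, of n] s01(1)[of "t + \<epsilon> n"] \<epsilon>[of n] that by (smt (verit) divide_nonneg_pos)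
  have \<phi>1: "\<phi> n t \<le> 1 / t" if "t > 0" for n t
  proof -
    have "\<phi> n t \<le> s (t + 3 * \<epsilon> n) / (t + \<epsilon> n)" using b(2) that by simp
    also have "\<dots> \<le> 1 / t" using s01[of "t + 3 * \<epsilon> n"] \<epsilon>[of n] that by (intro frac_le) auto
    finally show ?thesis .
  qed
  have lim: "(\<lambda>n. \<phi> n t) \<longlonglongrightarrow> h t" if t: "t > 0" for t
  proof -
    have "isCont s t" using continuous_s t by (simp add: continuous_on_eq_continuous_at)
    then have S: "(\<lambda>n. s (t + c * \<epsilon> n)) \<longlonglongrightarrow> s t" for c
      by (rule isCont_tendsto_compose) (use tendsto_add[OF tendsto_const tendsto_mult[OF tendsto_const \<epsilon>0], of t c] in simp)
    have T: "(\<lambda>n. t + \<epsilon> n) \<longlonglongrightarrow> t" using tendsto_add[OF tendsto_const \<epsilon>0, of t] by simp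
    show ?thesis unfolding h_def
      by (rule tendsto_sandwich[OF _ _ tendsto_divide[OF S[of 1] T] tendsto_divide[OF S[of 3] T]])
         (use b t in auto)
  qed
  have lims: "(\<lambda>n. sphere_mean e (\<phi> n) r q) \<longlonglongrightarrow> sphere_mean e h r q" (is ?L1)
    "(\<lambda>n. sphere_flux e (\<phi> n) r q) \<longlonglongrightarrow> sphere_flux e h r q" (is ?L2)
    if r: "r > 0" "r \<noteq> q" for r
  proof -
    define B where "B = 1 / (r - q)\<^sup>2"
    have T: "0 < sqdist r q \<tau>" "\<bar>\<phi> n (sqdist r q \<tau>)\<bar> \<le> B" if "\<bar>\<tau>\<bar> \<le> 1" for n \<tau>
    proof -
      have 1: "(r - q)\<^sup>2 \<le> sqdist r q \<tau>" "(r - q)\<^sup>2 > 0" using sqdist_ge[OF that, of r q] r q by auto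
      then show 2: "0 < sqdist r q \<tau>" by linarith
      have "1 / sqdist r q \<tau> \<le> B" unfolding B_def using 1 2 by (intro frac_le) auto
      then show "\<bar>\<phi> n (sqdist r q \<tau>)\<bar> \<le> B"
        using \<phi>0[of "sqdist r q \<tau>" n] \<phi>1[OF 2, of n] 2 by simp
    qed
    show ?L1 unfolding sphere_mean_def
    proof (rule integral_dominated_convergence[where w = "\<lambda>_. B"])
      show "AE \<tau> in cap_law e. (\<lambda>n. \<phi> n (sqdist r q \<tau>)) \<longlonglongrightarrow> h (sqdist r q \<tau>)"
        using AE_cap_law[OF e] by eventually_elim (intro lim T)
      show "AE \<tau> in cap_law e. norm (\<phi> n (sqdist r q \<tau>)) \<le> B" for n
        using AE_cap_law[OF e] by eventually_elim (simp add: T)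
    qed auto
    show ?L2 unfolding sphere_flux_def
    proof (rule integral_dominated_convergence[where w = "\<lambda>_. (r + q) * B"])
      show "AE \<tau> in cap_law e. (\<lambda>n. (r + q * \<tau>) * \<phi> n (sqdist r q \<tau>)) \<longlonglongrightarrow> (r + q * \<tau>) * h (sqdist r q \<tau>)"
        using AE_cap_law[OF e] by eventually_elim (intro tendsto_mult tendsto_const lim T)
      show "AE \<tau> in cap_law e. norm ((r + q * \<tau>) * \<phi> n (sqdist r q \<tau>)) \<le> (r + q) * B" for n
        using AE_cap_law[OF e]
      proof eventually_elim
        fix \<tau> :: real assume \<tau>: "\<bar>\<tau>\<bar> \<le> 1"
        have "\<bar>q * \<tau>\<bar> \<le> q" using \<tau> q by (simp add: abs_mult mult_left_le)
        then have "\<bar>r + q * \<tau>\<bar> \<le> r + q" using r by (simp add: abs_le_iff)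
        then have "\<bar>r + q * \<tau>\<bar> * \<bar>\<phi> n (sqdist r q \<tau>)\<bar> \<le> (r + q) * B"
          using T(2)[OF \<tau>, of n] q r by (intro mult_mono) auto
        then show "norm ((r + q * \<tau>) * \<phi> n (sqdist r q \<tau>)) \<le> (r + q) * B" by (simp add: abs_mult)
      qed
    qed auto
  qed
  show "(real DIM('a) - 2) / DIM('a) * r * sphere_mean e h r q \<le> sphere_flux e h r q" if "r > 0" "r \<noteq> q"
    by (rule LIMSEQ_le[OF tendsto_mult[OF tendsto_const lims(1)[OF that]] lims(2)[OF that]])
       (use superharmonic_profile.flux_ge_mean[OF \<phi> that(1)] in blast)
  show "r\<^sup>2 * sphere_mean e h r q \<le> r'\<^sup>2 * sphere_mean e h r' q" if "0 < r" "r \<le> r'" "r \<noteq> q" "r' \<noteq> q"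
    by (rule LIMSEQ_le[OF tendsto_mult[OF tendsto_const lims(1)] tendsto_mult[OF tendsto_const lims(1)]])
       (use superharmonic_profile.sq_times_sphere_mean_mono[OF \<phi> q, of r r'] that in auto)
  show "r\<^sup>2 * sphere_mean e h r q \<le> 1" if r: "r > 0" "r \<noteq> q"
  proof (rule LIMSEQ_le_const2[OF tendsto_mult[OF tendsto_const lims(1)[OF r]]], intro exI allI impI)
    fix n
    have "sphere_mean e (\<phi> n) r q \<le> 1 / r\<^sup>2"
      using superharmonic_profile.sphere_mean_le[OF \<phi> q, of n r] \<phi>1[of "r\<^sup>2" n] r by simp
    then show "r\<^sup>2 * sphere_mean e (\<phi> n) r q \<le> 1"
      using r by (simp add: field_simps)
  qed
qed

end

section \<open>Integrals of the singular profile against a radial weight\<close>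

lemma AE_norm_neq:
  "AE x in lborel. norm (x::'a::euclidean_space) \<noteq> q"
proof -
  have "sphere (0::'a) q \<in> null_sets lebesgue"
    using negligible_sphere negligible_iff_null_sets by blast
  then have "sphere (0::'a) q \<in> null_sets lborel"
    by (auto simp: null_sets_def)
  from AE_not_in[OF this] show ?thesis by simp
qed

context concave_profile
begin

lemma integrable_ratio_sqdist:
  assumes e: "norm e = 1" and r: "r > 0" "q \<ge> 0" "r \<noteq> q"
    and g: "continuous_on UNIV g"
  shows "integrable (cap_law e) (\<lambda>\<tau>. g \<tau> * (s (sqdist r q \<tau>) / sqdist r q \<tau>))"
proof -
  interpret C: prob_space "cap_law e" by (rule prob_space_cap_law)
  have [measurable]: "g \<in> borel_measurable borel" using g by (rule borel_measurable_continuous_onI)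
  have [measurable]: "sqdist r q \<in> borel_measurable borel"
    unfolding sqdist_def[abs_def] by measurable
  have "bounded (g ` {-1..1})"
    by (intro compact_imp_bounded compact_continuous_image continuous_on_subset[OF g]) auto
  then obtain B where B: "\<forall>x\<in>{-1..1}. \<bar>g x\<bar> \<le> B" unfolding bounded_iff by auto
  show ?thesis
  proof (rule C.integrable_const_bound[where B = "B * (1 / (r - q)\<^sup>2)"])
    show "AE \<tau> in cap_law e. norm (g \<tau> * (s (sqdist r q \<tau>) / sqdist r q \<tau>)) \<le> B * (1 / (r - q)\<^sup>2)"
      using AE_cap_law[OF e]
    proof eventually_elim
      fix \<tau> :: real assume \<tau>: "\<bar>\<tau>\<bar> \<le> 1"
      have 1: "(r - q)\<^sup>2 \<le> sqdist r q \<tau>" "(r - q)\<^sup>2 > 0" using sqdist_ge[OF \<tau>, of r q] r by auto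
      then have 2: "0 < sqdist r q \<tau>" by linarith
      with 1 have "\<bar>s (sqdist r q \<tau>) / sqdist r q \<tau>\<bar> \<le> 1 / (r - q)\<^sup>2"
        using s01[of "sqdist r q \<tau>"] by (auto intro!: frac_le)
      moreover have "\<bar>g \<tau>\<bar> \<le> B" using B \<tau> by (auto simp: abs_le_iff)
      ultimately show "norm (g \<tau> * (s (sqdist r q \<tau>) / sqdist r q \<tau>)) \<le> B * (1 / (r - q)\<^sup>2)"
        unfolding real_norm_def abs_mult by (intro mult_mono) auto
    qed
  qed simp
qed

text \<open>Monotonicity carries positivity to the right of a point where \<open>s\<close> is
  positive; to its left, the chord from 0 does, by concavity.\<close>

lemma s_pos:
  assumes "\<exists>t\<ge>0. s t \<noteq> 0" and t: "t > 0"
  shows "s t > 0"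
proof -
  obtain t0 where t0: "t0 \<ge> 0" "s t0 > 0" using assms(1) s01(1) by (metis less_eq_real_def)
  show ?thesis
  proof (cases "t0 \<le> t")
    case True
    then show ?thesis using s_mono[OF t0(1) True] t0(2) by simp
  next
    case False
    have "(1 - t / t0) * s 0 + t / t0 * s t0 \<le> s ((1 - t / t0) *\<^sub>R 0 + (t / t0) *\<^sub>R t0)"
      by (rule concave_onD[OF s_concave]) (use False t in auto)
    moreover have "0 \<le> (1 - t / t0) * s 0" using False t s01(1)[of 0] by simp
    moreover have "0 < t / t0 * s t0" using t0 t False by simp
    ultimately show ?thesis using False t by simp
  qed
qed

lemma sphere_mean_ratio_pos:
  assumes e: "norm e = 1" and r: "r > 0" "q \<ge> 0" "r \<noteq> q" and nz: "\<exists>t\<ge>0. s t \<noteq> 0"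
  shows "sphere_mean e (\<lambda>t. s t / t) r q > 0"
proof -
  interpret C: prob_space "cap_law e" by (rule prob_space_cap_law)
  \<comment> \<open>On the sphere the norm lies between \<open>\<bar>r - q\<bar>\<close> and
    \<open>r + q\<close>: the numerator is smallest at the nearest point, the denominator largest at
    the farthest.\<close>
  let ?c = "s ((r - q)\<^sup>2) / (r + q)\<^sup>2"
  have "0 < ?c" using s_pos[OF nz, of "(r - q)\<^sup>2"] r by simp
  also have "?c = (\<integral>\<tau>. ?c \<partial>cap_law e)" by (simp add: C.prob_space[unfolded space_cap_law])
  also have "\<dots> \<le> sphere_mean e (\<lambda>t. s t / t) r q"
    unfolding sphere_mean_def
  proof (rule cap_law_mono[OF e])
    show "integrable (cap_law e) (\<lambda>\<tau>. s (sqdist r q \<tau>) / sqdist r q \<tau>)"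
      using integrable_ratio_sqdist[OF e r, of "\<lambda>_. 1"] by simp
    fix \<tau> :: real assume \<tau>: "\<bar>\<tau>\<bar> \<le> 1"
    have 1: "(r - q)\<^sup>2 \<le> sqdist r q \<tau>" "(r - q)\<^sup>2 > 0" using sqdist_ge[OF \<tau>, of r q] r by auto
    then have "0 < sqdist r q \<tau>" by linarith
    with 1 show "?c \<le> s (sqdist r q \<tau>) / sqdist r q \<tau>"
      using sqdist_le[OF \<tau>, of r q] r s_mono[OF _ 1(1)] s01(1)[of "sqdist r q \<tau>"] by (intro frac_le) auto
  qed simp
  finally show ?thesis .
qed

text \<open>Chebyshev's correlation inequality in pointwise form: \<open>N0\<close> is the value of the increasing function
  \<open>r\<^sup>2 * sphere_mean\<close> where the decreasing factor changes sign. The infimum is only there to avoid the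
  radius \<open>r = q\<close>, at which the sphere meets the singularity.\<close>

lemma sphere_mean_crossing:
  fixes e :: "'a::euclidean_space"
  assumes e: "norm e = 1" and dim: "DIM('a) \<ge> 4" and q: "q \<ge> 0" and nz: "\<exists>t\<ge>0. s t \<noteq> 0"
    and ac: "a > 0" "c > 0"
  obtains N0 where "N0 > 0"
    "\<And>r. r > 0 \<Longrightarrow> r \<noteq> q \<Longrightarrow>
      (r\<^sup>2 * sphere_mean e (\<lambda>t. s t / t) r q) * (a / r\<^sup>2 - c) \<le> N0 * (a / r\<^sup>2 - c)"
proof -
  define N where "N r = r\<^sup>2 * sphere_mean e (\<lambda>t. s t / t) r q" for r
  define R where "R = sqrt (a / c)"
  have R: "R > 0" "R\<^sup>2 = a / c" using ac by (simp_all add: R_def)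
  have pos: "N r > 0" if "r > 0" "r \<noteq> q" for r
    using sphere_mean_ratio_pos[OF e that(1) q that(2) nz] that by (simp add: N_def)
  have mono: "N r \<le> N r'" if "0 < r" "r \<le> r'" "r \<noteq> q" "r' \<noteq> q" for r r'
    unfolding N_def by (rule sq_mean_mono[OF e dim q that])
  define S where "S = N ` {r. r > R \<and> r \<noteq> q}"
  have "R + q + 1 \<in> {r. r > R \<and> r \<noteq> q}" using R q by auto
  then have ne: "S \<noteq> {}" unfolding S_def by blast
  have bdd: "bdd_below S"
    unfolding S_def by (rule bdd_belowI[of _ 0]) (use pos R in \<open>auto intro: less_imp_le\<close>)
  have le: "N r \<le> Inf S" if "0 < r" "r \<le> R" "r \<noteq> q" for r
    by (rule cInf_greatest[OF ne]) (use that mono[of r] in \<open>auto simp: S_def\<close>)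
  show ?thesis
  proof (rule that)
    show "Inf S > 0"
    \<comment> \<open>Any radius below \<open>R\<close> other than \<open>q\<close> bounds the
      infimum below by a positive value; one of R / 2 and R / 3 qualifies.\<close>
    proof (cases "R / 2 = q")
      case True
      then have "N (R / 3) \<le> Inf S" "N (R / 3) > 0" using R by (intro le pos; simp)+
      then show ?thesis by simp
    next
      case False
      then have "N (R / 2) \<le> Inf S" "N (R / 2) > 0" using R by (intro le pos; simp)+
      then show ?thesis by simp
    qed
    fix r assume r: "r > 0" "r \<noteq> q"
    show "(r\<^sup>2 * sphere_mean e (\<lambda>t. s t / t) r q) * (a / r\<^sup>2 - c) \<le> Inf S * (a / r\<^sup>2 - c)"
      unfolding N_def[symmetric]
    proof (cases "r \<le> R")
      case True
      then have "r\<^sup>2 \<le> a / c" unfolding R(2)[symmetric] using r by (intro power_mono) auto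
      then have "0 \<le> a / r\<^sup>2 - c" using ac r by (simp add: field_simps)
      then show "N r * (a / r\<^sup>2 - c) \<le> Inf S * (a / r\<^sup>2 - c)"
        by (rule mult_right_mono[OF le[OF r(1) True r(2)]])
    next
      case False
      then have "a / c \<le> r\<^sup>2" unfolding R(2)[symmetric] using R by (intro power_mono) auto
      then have "a / r\<^sup>2 - c \<le> 0" using ac r by (simp add: field_simps)
      moreover have "Inf S \<le> N r" by (rule cInf_lower[OF _ bdd]) (use False r in \<open>auto simp: S_def\<close>)
      ultimately show "N r * (a / r\<^sup>2 - c) \<le> Inf S * (a / r\<^sup>2 - c)"
        by (rule mult_right_mono_neg[rotated])
    qed
  qed
qed

lemma norm_shift_polar:
  fixes e z :: "'a::euclidean_space"
  assumes e: "norm e = 1"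
  shows "(norm (z + q *\<^sub>R e))\<^sup>2 = sqdist (norm z) q (direction_cos e z)"
    and "inner z (z + q *\<^sub>R e) = norm z * (norm z + q * direction_cos e z)"
proof -
  have ee: "inner e e = 1" using e by (simp add: norm_eq_1)
  have *: "inner e z = norm z * direction_cos e z" by (simp add: direction_cos_def)
  show "(norm (z + q *\<^sub>R e))\<^sup>2 = sqdist (norm z) q (direction_cos e z)"
  proof -
    have "(norm (z + q *\<^sub>R e))\<^sup>2 = inner (z + q *\<^sub>R e) (z + q *\<^sub>R e)" by (rule power2_norm_eq_inner)
    also have "\<dots> = inner z z + 2 * q * inner e z + q\<^sup>2"
      by (simp add: inner_add inner_commute ee power2_eq_square)
    also have "inner z z = (norm z)\<^sup>2" by (rule power2_norm_eq_inner[symmetric])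
    finally show ?thesis unfolding * sqdist_def by simp
  qed
  show "inner z (z + q *\<^sub>R e) = norm z * (norm z + q * direction_cos e z)"
    using * by (simp add: inner_add inner_commute power2_norm_eq_inner[symmetric] power2_eq_square algebra_simps)
qed

text \<open>The ratio is singular at \<open>- q *\<^sub>R e\<close>, where \<open>v\<close> need not
  be small. Averaging over directions first removes this singularity: by \<open>sq_mean_le_1\<close>
  the mean of the ratio at radius r is at most 1 / r^2, so the assumed integrability
  suffices.\<close>

lemma integrable_weighted_ratio:
  fixes e :: "'a::euclidean_space" and v :: "real \<Rightarrow> real"
  assumes e: "norm e = 1" and dim: "DIM('a) \<ge> 4" and q: "q \<ge> 0"
    and [measurable]: "v \<in> borel_measurable borel" and v: "\<And>r. v r \<ge> 0"
    and int: "integrable lborel (\<lambda>z::'a. v (norm z) / (norm z)\<^sup>2)"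
  shows "integrable lborel (\<lambda>z. v (norm z) * (s ((norm (z + q *\<^sub>R e))\<^sup>2) / (norm (z + q *\<^sub>R e))\<^sup>2))"
proof (rule integrableI_bounded)
  let ?h = "\<lambda>t. s t / t"
  have [measurable]: "(\<lambda>p. sqdist (fst p) q (snd p)) \<in> borel_measurable (borel \<Otimes>\<^sub>M borel)"
    unfolding sqdist_def by measurable
  define G where "G p = ennreal (v (fst p) * \<bar>?h (sqdist (fst p) q (snd p))\<bar>)" for p
  have [measurable]: "G \<in> borel_measurable (borel \<Otimes>\<^sub>M borel)" unfolding G_def by measurable
  have "(\<integral>\<^sup>+ z. norm (v (norm z) * (s ((norm (z + q *\<^sub>R e))\<^sup>2) / (norm (z + q *\<^sub>R e))\<^sup>2)) \<partial>lborel)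
      = (\<integral>\<^sup>+ z. G (norm z, direction_cos e z) \<partial>lborel)"
    by (simp add: G_def norm_shift_polar[OF e] abs_mult v)
  also have "\<dots> = (\<integral>\<^sup>+ z. (\<integral>\<^sup>+ \<tau>. G (norm (z::'a), \<tau>) \<partial>cap_law e) \<partial>lborel)"
    by (rule nn_integral_polar) measurable
  also have "\<dots> \<le> (\<integral>\<^sup>+ z. ennreal (v (norm (z::'a)) / (norm z)\<^sup>2) \<partial>lborel)"
  proof (rule nn_integral_mono_AE)
    show "AE z in lborel. (\<integral>\<^sup>+ \<tau>. G (norm (z::'a), \<tau>) \<partial>cap_law e) \<le> ennreal (v (norm z) / (norm z)\<^sup>2)"
      using AE_norm_neq[of q] AE_norm_neq[of 0]
    proof eventually_elim
      fix z :: 'a assume z: "norm z \<noteq> q" "norm z \<noteq> 0"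
      define r where "r = norm z"
      have r: "r > 0" "r \<noteq> q" using z by (auto simp: r_def)
      have i: "integrable (cap_law e) (\<lambda>\<tau>. ?h (sqdist r q \<tau>))"
        using integrable_ratio_sqdist[OF e r(1) q r(2), of "\<lambda>_. 1"] by simp
      have "(\<integral>\<^sup>+ \<tau>. G (r, \<tau>) \<partial>cap_law e) = (\<integral>\<^sup>+ \<tau>. ennreal (v r * ?h (sqdist r q \<tau>)) \<partial>cap_law e)"
      proof (rule nn_integral_cong_AE)
        show "AE \<tau> in cap_law e. G (r, \<tau>) = ennreal (v r * ?h (sqdist r q \<tau>))"
          using AE_cap_law[OF e]
          by eventually_elim (simp add: G_def sqdist_nonneg s01)
      qed
      also have "\<dots> = ennreal (\<integral>\<tau>. v r * ?h (sqdist r q \<tau>) \<partial>cap_law e)"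
      proof (rule nn_integral_eq_integral)
        show "AE \<tau> in cap_law e. 0 \<le> v r * ?h (sqdist r q \<tau>)"
          using AE_cap_law[OF e] by eventually_elim (intro mult_nonneg_nonneg v divide_nonneg_nonneg s01 sqdist_nonneg)
      qed (intro integrable_mult_right i)
      also have "\<dots> = ennreal (v r * sphere_mean e ?h r q)"
        unfolding sphere_mean_def by (simp only: integral_mult_right_zero)
      also have "\<dots> \<le> ennreal (v r / r\<^sup>2)"
      proof (rule ennreal_leI)
        have "sphere_mean e ?h r q \<le> 1 / r\<^sup>2"
          using sq_mean_le_1[OF e dim q r] r by (simp add: field_simps)
        from mult_left_mono[OF this v, of r] show "v r * sphere_mean e ?h r q \<le> v r / r\<^sup>2" by simp
      qed
      finally show "(\<integral>\<^sup>+ \<tau>. G (norm z, \<tau>) \<partial>cap_law e) \<le> ennreal (v (norm z) / (norm z)\<^sup>2)"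
        by (simp add: r_def)
    qed
  qed
  also have "\<dots> = (\<integral>\<^sup>+ z. ennreal (norm (v (norm (z::'a)) / (norm z)\<^sup>2)) \<partial>lborel)" by (simp add: v)
  also have "\<dots> < \<infinity>" using int unfolding integrable_iff_bounded by blast
  finally show "(\<integral>\<^sup>+ z. norm (v (norm z) * (s ((norm (z + q *\<^sub>R e))\<^sup>2) / (norm (z + q *\<^sub>R e))\<^sup>2)) \<partial>lborel) < \<infinity>" .
qed measurable

text \<open>\<open>w\<close> stands for the star density as a function of the radius, left
  unnormalised so that \<open>bound\<close> compares two integrals. All inequalities at fixed radius
  are weak; strictness comes from \<open>bound\<close> together with \<open>N0 > 0\<close>.\<close>

lemma weighted_shrinkage_negative:
  fixes \<theta> :: "'a::euclidean_space" and w :: "real \<Rightarrow> real" and a :: real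
  assumes dim: "DIM('a) \<ge> 4" and nz: "\<exists>t\<ge>0. s t \<noteq> 0" and a: "a > 0"
    and [measurable]: "w \<in> borel_measurable borel" and w: "\<And>r. w r \<ge> 0"
    and int: "integrable lborel (\<lambda>z::'a. w (norm z))" "integrable lborel (\<lambda>z::'a. w (norm z) / (norm z)\<^sup>2)"
    and bound: "a * (\<integral>z. w (norm (z::'a)) / (norm z)\<^sup>2 \<partial>lborel)
      < 2 * (real DIM('a) - 2) / DIM('a) * (\<integral>z. w (norm (z::'a)) \<partial>lborel)"
  defines "G \<equiv> \<lambda>z. w (norm z) * (s ((norm (z + \<theta>))\<^sup>2) / (norm (z + \<theta>))\<^sup>2 * (a - 2 * inner z (z + \<theta>)))"
  shows "integrable lborel G" and "(\<integral>z. G z \<partial>lborel) < 0"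
proof -
  obtain e q where e: "norm e = 1" and \<theta>: "\<theta> = q *\<^sub>R e" and q: "q \<ge> 0"
  proof (cases "\<theta> = 0")
    case True
    obtain b :: 'a where "b \<in> Basis" using nonempty_Basis by blast
    then show ?thesis using that[of b 0] True by simp
  next
    case False
    then show ?thesis using that[of "\<theta> /\<^sub>R norm \<theta>" "norm \<theta>"] by simp
  qed
  let ?h = "\<lambda>t. s t / t"
  let ?H = "\<lambda>z. ?h ((norm (z + \<theta>))\<^sup>2)"
  have [measurable]: "(\<lambda>p. sqdist (fst p) q (snd p)) \<in> borel_measurable (borel \<Otimes>\<^sub>M borel)"
    unfolding sqdist_def by measurable
  have H0: "0 \<le> ?H z" "?H z * (norm (z + \<theta>))\<^sup>2 \<le> 1" for z using s01[of "(norm (z + \<theta>))\<^sup>2"] by auto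
  have i1: "integrable lborel (\<lambda>z. w (norm z) * ?H z)"
    unfolding \<theta> by (rule integrable_weighted_ratio[OF e dim q _ w int(2)]) measurable
  \<comment> \<open>With weight \<open>w r * r\<^sup>2\<close>, the hypothesis of
    \<open>integrable_weighted_ratio\<close> becomes integrability of \<open>w\<close>
    itself.\<close>
  have i2: "integrable lborel (\<lambda>z. (w (norm z) * (norm z)\<^sup>2) * ?H z)"
    unfolding \<theta>
  proof (rule integrable_weighted_ratio[OF e dim q, where v = "\<lambda>r. w r * r\<^sup>2"])
    show "integrable lborel (\<lambda>z::'a. w (norm z) * (norm z)\<^sup>2 / (norm z)\<^sup>2)"
      by (rule integrable_cong_AE_imp[OF int(1)], measurable) (use AE_norm_neq[of 0] in \<open>eventually_elim, simp\<close>)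
  qed (use w in auto)
  \<comment> \<open>The inner product is at most |z|^2 + |z + \<theta>|^2 in absolute value. The
    ratio times the second square is a value of \<open>s\<close> or 0, hence at most 1, and the
    first square is handled by \<open>i2\<close>.\<close>
  have i3: "integrable lborel (\<lambda>z. w (norm z) * (?H z * inner z (z + \<theta>)))"
  proof (rule Bochner_Integration.integrable_bound)
    show "integrable lborel (\<lambda>z. (w (norm z) * (norm z)\<^sup>2) * ?H z + w (norm z))"
      by (intro Bochner_Integration.integrable_add i2 int(1))
    show "AE z in lborel. norm (w (norm z) * (?H z * inner z (z + \<theta>))) \<le> norm ((w (norm z) * (norm z)\<^sup>2) * ?H z + w (norm z))"
    proof (rule AE_I2)
      fix z
      have "\<bar>inner z (z + \<theta>)\<bar> \<le> norm z * norm (z + \<theta>)" by (rule Cauchy_Schwarz_ineq2)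
      also have "\<dots> \<le> (norm z)\<^sup>2 + (norm (z + \<theta>))\<^sup>2"
        using sum_squares_bound[of "norm z" "norm (z + \<theta>)"] mult_nonneg_nonneg[OF norm_ge_zero[of z] norm_ge_zero[of "z + \<theta>"]]
        unfolding mult.assoc by linarith
      finally have "?H z * \<bar>inner z (z + \<theta>)\<bar> \<le> ?H z * (norm z)\<^sup>2 + ?H z * (norm (z + \<theta>))\<^sup>2"
        unfolding distrib_left[symmetric] by (rule mult_left_mono) (rule H0)
      also have "\<dots> \<le> ?H z * (norm z)\<^sup>2 + 1" using H0 by simp
      finally have "w (norm z) * (?H z * \<bar>inner z (z + \<theta>)\<bar>) \<le> w (norm z) * (?H z * (norm z)\<^sup>2 + 1)"
        by (rule mult_left_mono) (rule w)
      moreover have "w (norm z) * (?H z * (norm z)\<^sup>2 + 1) = (w (norm z) * (norm z)\<^sup>2) * ?H z + w (norm z)"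
        by (simp only: distrib_left mult_ac mult_1_right)
      moreover have "norm (w (norm z) * (?H z * inner z (z + \<theta>))) = w (norm z) * (?H z * \<bar>inner z (z + \<theta>)\<bar>)"
        unfolding real_norm_def abs_mult using w H0(1)[of z] by (simp only: abs_of_nonneg)
      ultimately show "norm (w (norm z) * (?H z * inner z (z + \<theta>))) \<le> norm ((w (norm z) * (norm z)\<^sup>2) * ?H z + w (norm z))"
        by (simp only: real_norm_def)
    qed
  qed measurable
  have "integrable lborel (\<lambda>z. a * (w (norm z) * ?H z) - 2 * (w (norm z) * (?H z * inner z (z + \<theta>))))"
    by (intro Bochner_Integration.integrable_diff integrable_mult_right i1 i3)
  also have "(\<lambda>z. a * (w (norm z) * ?H z) - 2 * (w (norm z) * (?H z * inner z (z + \<theta>)))) = G"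
  proof -
    have "a * (W * H) - 2 * (W * (H * I)) = W * (H * (a - 2 * I))" for W H I :: real
      by (simp add: algebra_simps)
    then show ?thesis unfolding G_def by (simp only:)
  qed
  finally show iG: "integrable lborel G" .
  define K where "K p = w (fst p) * (?h (sqdist (fst p) q (snd p)) * (a - 2 * (fst p * (fst p + q * snd p))))" for p
  have [measurable]: "K \<in> borel_measurable (borel \<Otimes>\<^sub>M borel)" unfolding K_def by measurable
  have GK: "G = (\<lambda>z. K (norm z, direction_cos e z))"
    by (rule ext) (simp add: G_def K_def \<theta> norm_shift_polar[OF e])
  let ?c = "2 * (real DIM('a) - 2) / DIM('a)"
  have c: "?c > 0" using dim by simp
  obtain N0 where N0: "N0 > 0" "\<And>r. r > 0 \<Longrightarrow> r \<noteq> q \<Longrightarrow>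
      (r\<^sup>2 * sphere_mean e ?h r q) * (a / r\<^sup>2 - ?c) \<le> N0 * (a / r\<^sup>2 - ?c)"
    using sphere_mean_crossing[OF e dim q nz a c] by blast
  have "(\<integral>z. G z \<partial>lborel) = (\<integral>z. (\<integral>\<tau>. K (norm (z::'a), \<tau>) \<partial>cap_law e) \<partial>lborel)"
    unfolding GK by (rule integral_polar(1)[OF _ iG[unfolded GK]]) measurable
  also have "\<dots> \<le> (\<integral>z. N0 * (a * (w (norm (z::'a)) / (norm z)\<^sup>2) - ?c * w (norm z)) \<partial>lborel)"
  proof (rule integral_mono_AE)
    show "integrable lborel (\<lambda>z::'a. \<integral>\<tau>. K (norm z, \<tau>) \<partial>cap_law e)"
      by (rule integral_polar(2)[OF _ iG[unfolded GK]]) measurable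
    show "integrable lborel (\<lambda>z::'a. N0 * (a * (w (norm z) / (norm z)\<^sup>2) - ?c * w (norm z)))"
      by (intro integrable_mult_right Bochner_Integration.integrable_diff int)
    show "AE z in lborel. (\<integral>\<tau>. K (norm (z::'a), \<tau>) \<partial>cap_law e) \<le> N0 * (a * (w (norm z) / (norm z)\<^sup>2) - ?c * w (norm z))"
      using AE_norm_neq[of q] AE_norm_neq[of 0]
    proof eventually_elim
      fix z :: 'a assume z: "norm z \<noteq> q" "norm z \<noteq> 0"
      define r where "r = norm z"
      have r: "r > 0" "r \<noteq> q" using z by (auto simp: r_def)
      have i: "integrable (cap_law e) (\<lambda>\<tau>. ?h (sqdist r q \<tau>))"
        "integrable (cap_law e) (\<lambda>\<tau>. (r + q * \<tau>) * ?h (sqdist r q \<tau>))"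
        using integrable_ratio_sqdist[OF e r(1) q r(2), of "\<lambda>_. 1"]
        by simp (intro integrable_ratio_sqdist[OF e r(1) q r(2)] continuous_intros)
      have "(\<integral>\<tau>. K (r, \<tau>) \<partial>cap_law e) = (\<integral>\<tau>. w r * (a * ?h (sqdist r q \<tau>) - 2 * r * ((r + q * \<tau>) * ?h (sqdist r q \<tau>))) \<partial>cap_law e)"
        by (rule Bochner_Integration.integral_cong) (simp_all add: K_def algebra_simps add_divide_distrib diff_divide_distrib)
      also have "\<dots> = w r * (a * sphere_mean e ?h r q - 2 * r * sphere_flux e ?h r q)"
        unfolding sphere_mean_def sphere_flux_def integral_mult_right_zero
        by (subst Bochner_Integration.integral_diff) (use i in \<open>auto simp del: times_divide_eq_right\<close>)
      also have "\<dots> \<le> w r * ((r\<^sup>2 * sphere_mean e ?h r q) * (a / r\<^sup>2 - ?c))"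
      proof (rule mult_left_mono[OF _ w])
        have "2 * r * ((real DIM('a) - 2) / DIM('a) * r * sphere_mean e ?h r q) \<le> 2 * r * sphere_flux e ?h r q"
          using flux_ge[OF e dim q r] r by (intro mult_left_mono) auto
        moreover have "(r\<^sup>2 * sphere_mean e ?h r q) * (a / r\<^sup>2 - ?c)
          = a * sphere_mean e ?h r q - 2 * r * ((real DIM('a) - 2) / DIM('a) * r * sphere_mean e ?h r q)"
          using r by (simp add: right_diff_distrib power2_eq_square) (simp add: algebra_simps)
        ultimately show "a * sphere_mean e ?h r q - 2 * r * sphere_flux e ?h r q \<le> (r\<^sup>2 * sphere_mean e ?h r q) * (a / r\<^sup>2 - ?c)"
          by linarith
      qed
      also have "\<dots> \<le> w r * (N0 * (a / r\<^sup>2 - ?c))"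
        by (rule mult_left_mono[OF N0(2)[OF r] w])
      also have "\<dots> = N0 * (a * (w r / r\<^sup>2) - ?c * w r)" by (simp add: algebra_simps)
      finally show "(\<integral>\<tau>. K (norm z, \<tau>) \<partial>cap_law e) \<le> N0 * (a * (w (norm z) / (norm z)\<^sup>2) - ?c * w (norm z))"
        by (simp only: r_def)
    qed
  qed
  also have "\<dots> = N0 * (a * (\<integral>z. w (norm (z::'a)) / (norm z)\<^sup>2 \<partial>lborel) - ?c * (\<integral>z. w (norm (z::'a)) \<partial>lborel))"
  proof -
    have "(\<integral>z. a * (w (norm (z::'a)) / (norm z)\<^sup>2) - ?c * w (norm z) \<partial>lborel)
        = (\<integral>z. a * (w (norm (z::'a)) / (norm z)\<^sup>2) \<partial>lborel) - (\<integral>z. ?c * w (norm (z::'a)) \<partial>lborel)"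
      by (intro Bochner_Integration.integral_diff integrable_mult_right int)
    then show ?thesis by (simp only: integral_mult_right_zero)
  qed
  also have "\<dots> < 0" using N0(1) bound by (simp add: mult_pos_neg)
  finally show "(\<integral>z. G z \<partial>lborel) < 0" .
qed

end

section \<open>Concave loss\<close>

locale concave_loss =
  fixes l :: "real \<Rightarrow> real"
  assumes l_nonneg: "\<forall>t\<ge>0. 0 \<le> l t"
    and l_concave: "concave_on {0..} l"
    and l_zero: "l 0 = 0"
    and l_diff: "twice_differentiable_pos l"
    and l_deriv_pos: "\<forall>t>0. 0 < deriv l t"
begin

lemma l_deriv: "t > 0 \<Longrightarrow> (l has_field_derivative deriv l t) (at t)"
  using l_diff unfolding twice_differentiable_pos_def
  by (simp add: DERIV_deriv_iff_real_differentiable)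

lemma tangent_bound:
  assumes "v > 0" "u \<ge> 0" shows "l u \<le> l v + deriv l v * (u - v)"
proof -
  have "- deriv l v * (u - v) \<le> - l u - - l v"
  proof (rule convex_on_imp_above_tangent)
    show "convex_on {0..} (\<lambda>x. - l x)" using l_concave by (simp add: concave_on_def)
    show "((\<lambda>x. - l x) has_field_derivative - deriv l v) (at v within {0..})"
      by (rule DERIV_subset[OF DERIV_minus[OF l_deriv]]) (use assms in auto)
  qed (use assms in auto)
  then show ?thesis by simp
qed

lemma l_mono: assumes "0 \<le> u" "u \<le> v" shows "l u \<le> l v"
proof (cases "u = v")
  case False
  then have v: "v > 0" using assms by simp
  have "deriv l v * (u - v) \<le> 0" using l_deriv_pos v assms by (intro mult_nonneg_nonpos) (auto intro: less_imp_le)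
  then show ?thesis using tangent_bound[OF v assms(1)] by simp
qed simp

lemma l_linear_bound: assumes "v \<ge> 0" shows "l v \<le> l 1 + deriv l 1 * v"
proof -
  have "0 < deriv l 1" using l_deriv_pos by simp
  then show ?thesis using tangent_bound[of 1 v] assms by (simp add: algebra_simps)
qed

text \<open>The tangent at \<open>v\<close>, evaluated at 0 where the loss vanishes, bounds the
  slope by \<open>l v / v\<close>. The growth like 1 / v near 0 is matched by the inverse moment of
  the density.\<close>

lemma deriv_bound: assumes "v > 0" shows "deriv l v \<le> l 1 / v + deriv l 1"
proof -
  have "deriv l v * v \<le> l v" using tangent_bound[OF assms, of 0] l_zero by simp
  also have "\<dots> \<le> l 1 + deriv l 1 * v" using assms by (intro l_linear_bound) simp
  finally show ?thesis using assms by (simp add: field_simps)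
qed

lemma measurable_l: "(\<lambda>t. l (max 0 t)) \<in> borel_measurable borel"
  by (rule borel_measurable_mono) (auto simp: mono_def intro!: l_mono)

lemma measurable_deriv: "(\<lambda>t. indicator {0<..} t * deriv l t) \<in> borel_measurable borel"
proof -
  have "continuous_on {0<..} (deriv l)"
    using l_diff unfolding twice_differentiable_pos_def
    by (intro continuous_at_imp_continuous_on ballI) (auto intro: differentiable_imp_continuous_within)
  from borel_measurable_continuous_on_indicator[OF _ this] show ?thesis by simp
qed

end

text \<open>Both squared norms contribute \<open>k\<^sup>2 * (norm x)\<^sup>2\<close>, and the
  balance weights add up to 1. The factor \<open>1 - \<omega>\<close> inside \<open>k\<close> lets
  the quadratic and the cross term share \<open>(1 - \<omega>)\<^sup>2\<close>. At
  \<open>x = 0\<close> the quotient is 0 by convention, so the bound on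
  \<open>h * (norm x)\<^sup>2\<close> persists.\<close>

lemma shrinkage_excess_le:
  fixes x z :: "'a::real_inner"
  assumes \<omega>: "0 \<le> \<omega>" "\<omega> < 1" and a: "a > 0" and t: "0 \<le> t" "t \<le> 1"
  defines "h \<equiv> t / (norm x)\<^sup>2" and "k \<equiv> a * (1 - \<omega>) * (t / (norm x)\<^sup>2)"
  shows "\<omega> * (norm ((1 - k) *\<^sub>R x - x))\<^sup>2 + (1 - \<omega>) * (norm ((1 - k) *\<^sub>R x - (x - z)))\<^sup>2 - (1 - \<omega>) * (norm z)\<^sup>2
    \<le> a * (1 - \<omega>)\<^sup>2 * (h * (a - 2 * inner z x))"
proof -
  have 1: "(norm ((1 - k) *\<^sub>R x - x))\<^sup>2 = k\<^sup>2 * (norm x)\<^sup>2"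
    by (simp add: algebra_simps power_mult_distrib)
  have 2: "(norm ((1 - k) *\<^sub>R x - (x - z)))\<^sup>2 = (norm z)\<^sup>2 - 2 * k * inner z x + k\<^sup>2 * (norm x)\<^sup>2"
    unfolding power2_norm_eq_inner
    by (simp add: algebra_simps inner_diff inner_add inner_commute power2_eq_square)
  have "k\<^sup>2 * (norm x)\<^sup>2 = (a * (1 - \<omega>))\<^sup>2 * (h * (h * (norm x)\<^sup>2))"
    by (simp add: k_def h_def power2_eq_square)
  also have "\<dots> \<le> (a * (1 - \<omega>))\<^sup>2 * (h * 1)"
    using t by (intro mult_left_mono) (auto simp: h_def)
  finally have 3: "k\<^sup>2 * (norm x)\<^sup>2 \<le> (a * (1 - \<omega>))\<^sup>2 * h" by simp
  have "\<omega> * (norm ((1 - k) *\<^sub>R x - x))\<^sup>2 + (1 - \<omega>) * (norm ((1 - k) *\<^sub>R x - (x - z)))\<^sup>2 - (1 - \<omega>) * (norm z)\<^sup>2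
     = k\<^sup>2 * (norm x)\<^sup>2 - 2 * (1 - \<omega>) * k * inner z x"
    unfolding 1 2 by (simp add: algebra_simps)
  also have "\<dots> \<le> (a * (1 - \<omega>))\<^sup>2 * h - 2 * (1 - \<omega>) * k * inner z x" using 3 by simp
  also have "\<dots> = a * (1 - \<omega>)\<^sup>2 * (h * (a - 2 * inner z x))"
  proof -
    have "k = a * (1 - \<omega>) * h" by (simp add: k_def h_def)
    then show ?thesis by (simp only: power2_eq_square) (simp add: algebra_simps)
  qed
  finally show ?thesis .
qed

section \<open>Comparison of the risks\<close>

theorem theorem3p1:
  fixes f l s :: "real \<Rightarrow> real" and \<omega> a :: real
  assumes dim: "CARD('n::finite) \<ge> 4"
    and omega: "0 \<le> \<omega>" "\<omega> < 1"
    and f_meas: "(\<lambda>x :: real ^ 'n. f ((norm x)\<^sup>2)) \<in> borel_measurable borel"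
    and f_nonneg: "\<forall>t\<ge>0. 0 \<le> f t"
    and f_density: "prob_space (spherical_law f (0 :: real ^ 'n))"
    and second_moment:
      "(\<integral>\<^sup>+ x. ennreal ((norm x)\<^sup>2) \<partial>spherical_law f (0 :: real ^ 'n)) < \<infinity>"
    and inverse_moment:
      "(\<integral>\<^sup>+ x. inverse (ennreal ((norm x)\<^sup>2)) \<partial>spherical_law f (0 :: real ^ 'n)) < \<infinity>"
    and l_nonneg: "\<forall>t\<ge>0. 0 \<le> l t"
    and l_concave: "concave_on {0..} l"
    and l_zero: "l 0 = 0"
    and l_diff: "twice_differentiable_pos l"
    and l_deriv_pos: "\<forall>t>0. 0 < deriv l t"
    and s_range: "s ` {0..} \<subseteq> {0..1}"
    and s_mono: "mono_on {0..} s"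
    and s_concave: "concave_on {0..} s"
    and s_diff: "twice_differentiable_ae_pos s"
    and s_nonzero: "\<exists>t\<ge>0. s t \<noteq> 0"
    and a_pos: "0 < a"
    and a_bound:
      "ennreal a <
         ennreal (2 * (real CARD('n) - 2)) /
         (ennreal (real CARD('n)) *
           (\<integral>\<^sup>+ z. inverse (ennreal ((norm z)\<^sup>2)) \<partial>star_law f l \<omega> (0 :: real ^ 'n)))"
  shows "dominates (risk f l \<omega> (\<lambda>x. x))
           (shrinkage_estimator \<omega> a s) (\<lambda>x :: real ^ 'n. x)"
proof -
  interpret concave_loss l by standard (fact l_nonneg l_concave l_zero l_diff l_deriv_pos)+
  \<comment> \<open>Constant extension to the left of 0 makes the function monotone on the whole
    line, hence Borel, and changes nothing at squared norms.\<close>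
  define s0 where "s0 t = s (max 0 t)" for t
  have s0: "s0 t = s t" if "t \<ge> 0" for t using that by (simp add: s0_def)
  interpret concave_profile s0
  proof
    show "0 \<le> s0 t" "s0 t \<le> 1" for t using s_range by (auto simp: s0_def image_subset_iff)
    show "s0 t \<le> s0 u" if "t \<le> u" for t u
      unfolding s0_def by (rule mono_onD[OF s_mono]) (use that in auto)
    then show "s0 \<in> borel_measurable borel" by (intro borel_measurable_mono) (auto simp: mono_def)
    show "concave_on {0..} s0"
      using s_concave unfolding concave_on_iff by (auto simp: s0)
  qed
  have nz: "\<exists>t\<ge>0. s0 t \<noteq> 0" using s_nonzero s0 by force
  have estimator: "shrinkage_estimator \<omega> a s = (\<lambda>x :: real ^ 'n. (1 - a * (1 - \<omega>) * (s0 ((norm x)\<^sup>2) / (norm x)\<^sup>2)) *\<^sub>R x)"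
    by (rule ext) (simp add: shrinkage_estimator_def s0)

  define F :: "real ^ 'n \<Rightarrow> real" where "F z = f ((norm z)\<^sup>2)" for z
  have F0: "F z \<ge> 0" for z using f_nonneg by (simp add: F_def)
  have [measurable]: "F \<in> borel_measurable borel" using f_meas by (simp add: F_def[abs_def])
  have law: "spherical_law f \<theta> = density lborel (\<lambda>x. ennreal (F (x - \<theta>)))" for \<theta> :: "real ^ 'n"
    by (simp add: spherical_law_def F_def)
  have F1: "(\<integral>\<^sup>+ z. ennreal (F z) \<partial>lborel) = 1"
    using prob_space.emeasure_space_1[OF f_density] by (simp add: law emeasure_density)
  have iF: "integrable lborel F"
    by (rule integrableI_nonneg) (auto simp: F0 F1)
  have iF2: "integrable lborel (\<lambda>z. F z * (norm z)\<^sup>2)"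
    using second_moment by (intro integrableI_nonneg) (auto simp: F0 law nn_integral_density ennreal_mult)
  have z0: "AE z in lborel. (z :: real ^ 'n) \<noteq> 0" using AE_norm_neq[of 0] by simp
  have iF3: "integrable lborel (\<lambda>z. F z / (norm z)\<^sup>2)"
  proof (rule integrableI_nonneg)
    have "(\<integral>\<^sup>+ z. ennreal (F z / (norm z)\<^sup>2) \<partial>lborel) = (\<integral>\<^sup>+ z. ennreal (F z) * inverse (ennreal ((norm z)\<^sup>2)) \<partial>lborel)"
    proof (rule nn_integral_cong_AE)
      show "AE z in lborel. ennreal (F z / (norm z)\<^sup>2) = ennreal (F z) * inverse (ennreal ((norm z)\<^sup>2))"
        using z0 by eventually_elim (simp add: inverse_ennreal ennreal_mult[symmetric] F0 divide_inverse)
    qed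
    then show "(\<integral>\<^sup>+ z. ennreal (F z / (norm z)\<^sup>2) \<partial>lborel) < \<infinity>"
      using inverse_moment by (simp add: law nn_integral_density)
  qed (auto simp: F0)

  obtain b :: "real ^ 'n" where b: "b \<in> Basis" using nonempty_Basis by blast
  \<comment> \<open>The value 0 for \<open>r \<le> 0\<close> keeps the unspecified
    \<open>deriv l 0\<close> out; off the origin \<open>w (norm z)\<close> is the weight of the star
    law.\<close>
  define w where "w r = (if r > 0 then deriv l ((1 - \<omega>) * r\<^sup>2) * f (r\<^sup>2) else 0)" for r
  have w: "w r \<ge> 0" for r
  proof -
    have "0 \<le> deriv l ((1 - \<omega>) * r\<^sup>2)" if "r > 0" using l_deriv_pos omega that by (auto intro!: less_imp_le)
    then show ?thesis using f_nonneg by (simp add: w_def)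
  qed
  have w_meas [measurable]: "w \<in> borel_measurable borel"
  proof -
    note measurable_deriv[measurable]
    \<comment> \<open>Measurability is given for f(|x|^2) on the sample space; evaluating along the
      unit vector \<open>b\<close> recovers that of f(r^2) in the real variable r.\<close>
    have "(\<lambda>r. indicator {0<..} r * ((indicator {0<..} ((1 - \<omega>) * r\<^sup>2) * deriv l ((1 - \<omega>) * r\<^sup>2)) * F (r *\<^sub>R b))) \<in> borel_measurable borel"
      by (intro borel_measurable_times measurable_compose[OF _ measurable_deriv]) measurable
    also have "(\<lambda>r. indicator {0<..} r * ((indicator {0<..} ((1 - \<omega>) * r\<^sup>2) * deriv l ((1 - \<omega>) * r\<^sup>2)) * F (r *\<^sub>R b))) = w"
      using b omega by (auto simp: fun_eq_iff w_def F_def indicator_def)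
    finally show ?thesis .
  qed
  have wF: "w (norm z) = deriv l ((1 - \<omega>) * (norm z)\<^sup>2) * F z" if "z \<noteq> 0" for z
    using that by (simp add: w_def F_def)
  have iw: "integrable lborel (\<lambda>z :: real ^ 'n. w (norm z))"
  proof (rule Bochner_Integration.integrable_bound)
    show "integrable lborel (\<lambda>z. l 1 / (1 - \<omega>) * (F z / (norm z)\<^sup>2) + deriv l 1 * F z)"
      by (intro Bochner_Integration.integrable_add integrable_mult_right iF iF3)
    show "AE z in lborel. norm (w (norm z)) \<le> norm (l 1 / (1 - \<omega>) * (F z / (norm z)\<^sup>2) + deriv l 1 * F z)"
      using z0
    proof eventually_elim
      fix z :: "real ^ 'n" assume z: "z \<noteq> 0"
      have "w (norm z) \<le> (l 1 / ((1 - \<omega>) * (norm z)\<^sup>2) + deriv l 1) * F z"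
        unfolding wF[OF z] using z omega by (intro mult_right_mono deriv_bound F0) simp
      also have "\<dots> = l 1 / (1 - \<omega>) * (F z / (norm z)\<^sup>2) + deriv l 1 * F z"
        by (simp add: distrib_right)
      finally show "norm (w (norm z)) \<le> norm (l 1 / (1 - \<omega>) * (F z / (norm z)\<^sup>2) + deriv l 1 * F z)"
        using w[of "norm z"] by simp
    qed
  qed measurable

  define C where "C = (\<integral>z. w (norm (z :: real ^ 'n)) \<partial>lborel)"
  have C: "C > 0"
  proof -
    have "C \<noteq> 0"
    proof
      assume "C = 0"
      then have "AE z in lborel. w (norm (z :: real ^ 'n)) = 0"
        unfolding C_def by (subst (asm) integral_nonneg_eq_0_iff_AE[OF iw]) (auto simp: w)
      then have "AE z in lborel. F z = 0"
        using z0
      proof eventually_elim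
        fix z :: "real ^ 'n" assume "w (norm z) = 0" "z \<noteq> 0"
        moreover from this have "0 < deriv l ((1 - \<omega>) * (norm z)\<^sup>2)" using omega l_deriv_pos by simp
        ultimately show "F z = 0" using wF by auto
      qed
      then have "(\<integral>\<^sup>+ z. ennreal (F z) \<partial>lborel) = (\<integral>\<^sup>+ z. 0 \<partial>(lborel :: (real ^ 'n) measure))"
        by (intro nn_integral_cong_AE) (auto elim: eventually_mono)
      then show False using F1 by simp
    qed
    moreover have "C \<ge> 0" unfolding C_def by (rule integral_nonneg_AE) (simp add: w)
    ultimately show ?thesis by simp
  qed
  have star: "AE z in lborel. star_weight f l \<omega> 0 z = ennreal (w (norm (z :: real ^ 'n)))"
    using z0 by eventually_elim (simp add: star_weight_def wF F_def)
  have [measurable]: "star_weight f l \<omega> (0 :: real ^ 'n) \<in> borel_measurable borel"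
  proof -
    have "(\<lambda>z :: real ^ 'n. if z \<in> {0} then star_weight f l \<omega> 0 0 else ennreal (w (norm z))) \<in> borel_measurable borel"
      by measurable
    also have "(\<lambda>z :: real ^ 'n. if z \<in> {0} then star_weight f l \<omega> 0 0 else ennreal (w (norm z))) = star_weight f l \<omega> 0"
      by (auto simp: fun_eq_iff star_weight_def wF F_def)
    finally show ?thesis .
  qed
  have star_C: "(\<integral>\<^sup>+ z. star_weight f l \<omega> (0 :: real ^ 'n) z \<partial>lborel) = ennreal C"
    unfolding C_def nn_integral_eq_integral[OF iw AE_I2[OF w], symmetric]
    by (rule nn_integral_cong_AE[OF star])
  define I where "I = (\<integral>\<^sup>+ z. ennreal (w (norm (z :: real ^ 'n)) / (norm z)\<^sup>2) \<partial>lborel)"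
  have M: "(\<integral>\<^sup>+ z. inverse (ennreal ((norm z)\<^sup>2)) \<partial>star_law f l \<omega> (0 :: real ^ 'n)) = I / ennreal C"
  proof -
    have "(\<integral>\<^sup>+ z. inverse (ennreal ((norm z)\<^sup>2)) \<partial>star_law f l \<omega> (0 :: real ^ 'n))
       = (\<integral>\<^sup>+ z. star_weight f l \<omega> 0 z / ennreal C * inverse (ennreal ((norm (z :: real ^ 'n))\<^sup>2)) \<partial>lborel)"
      unfolding star_law_def star_C by (subst nn_integral_density) auto
    also have "\<dots> = (\<integral>\<^sup>+ z. ennreal (w (norm (z :: real ^ 'n)) / (norm z)\<^sup>2) / ennreal C \<partial>lborel)"
    proof (rule nn_integral_cong_AE)
      show "AE z in lborel. star_weight f l \<omega> 0 z / ennreal C * inverse (ennreal ((norm (z :: real ^ 'n))\<^sup>2))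
          = ennreal (w (norm z) / (norm z)\<^sup>2) / ennreal C"
        using star z0
        by eventually_elim (simp add: inverse_ennreal divide_ennreal ennreal_mult[symmetric] w C less_imp_le field_simps)
    qed
    also have "\<dots> = I / ennreal C" unfolding I_def by (rule nn_integral_divide) measurable
    finally show ?thesis .
  qed
  let ?d = "real CARD('n)"
  \<comment> \<open>Were \<open>I\<close> infinite, the quotient in \<open>a_bound\<close> would be
    0 in extended arithmetic, which excludes every \<open>a\<close>.\<close>
  have "I \<noteq> \<infinity>"
  proof
    assume "I = \<infinity>"
    then show False using a_bound dim unfolding M by (simp add: ennreal_top_divide)
  qed
  then have iw2: "integrable lborel (\<lambda>z :: real ^ 'n. w (norm z) / (norm z)\<^sup>2)"
    by (intro integrableI_nonneg) (auto simp: w I_def top.not_eq_extremum)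
  define J where "J = (\<integral>z. w (norm (z :: real ^ 'n)) / (norm z)\<^sup>2 \<partial>lborel)"
  have I: "I = ennreal J"
    unfolding I_def J_def by (rule nn_integral_eq_integral[OF iw2]) (simp add: w)
  have J: "J \<ge> 0" unfolding J_def by (rule integral_nonneg_AE) (simp add: w)
  have bound: "a * J < 2 * (?d - 2) / ?d * C"
  \<comment> \<open>For \<open>J = 0\<close> the quotient in \<open>a_bound\<close> is infinite, so
    the claim is read off from \<open>C > 0\<close> instead.\<close>
  proof (cases "J = 0")
    case True
    then show ?thesis using C dim by simp
  next
    case False
    then have "J > 0" using J by simp
    have "ennreal a < ennreal (2 * (?d - 2) / (?d * (J / C)))"
      using a_bound dim C \<open>J > 0\<close> unfolding M I
      by (simp add: divide_ennreal ennreal_mult[symmetric])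
    then have "a < 2 * (?d - 2) / (?d * (J / C))"
      using a_pos by (simp add: ennreal_less_iff)
    then show ?thesis using C dim \<open>J > 0\<close> by (simp add: field_simps)
  qed

  \<comment> \<open>Strict inequality is shown at every parameter, which yields both halves of
    \<open>dominates\<close>. It survives the passage to extended reals because both risks are
    finite.\<close>
  have main: "risk f l \<omega> (\<lambda>x. x) \<theta> (shrinkage_estimator \<omega> a s) < risk f l \<omega> (\<lambda>x. x) \<theta> (\<lambda>x. x)" for \<theta> :: "real ^ 'n"
  proof -
    define k where "k x = a * (1 - \<omega>) * (s0 ((norm x)\<^sup>2) / (norm x)\<^sup>2)" for x :: "real ^ 'n"
    define U where "U x = \<omega> * (norm ((1 - k x) *\<^sub>R x - x))\<^sup>2 + (1 - \<omega>) * (norm ((1 - k x) *\<^sub>R x - \<theta>))\<^sup>2" for x :: "real ^ 'n"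
    have U0: "U x \<ge> 0" for x using omega by (simp add: U_def)
    have [measurable]: "k \<in> borel_measurable borel" unfolding k_def[abs_def] by measurable
    have [measurable]: "U \<in> borel_measurable borel" unfolding U_def[abs_def] by measurable
    note measurable_l[measurable]
    have lU: "(\<lambda>x. l (U x)) \<in> borel_measurable borel"
      using measurable_compose[OF \<open>U \<in> borel_measurable borel\<close> measurable_l] U0 by (simp add: max_def)
    have lV: "(\<lambda>z :: real ^ 'n. l ((1 - \<omega>) * (norm z)\<^sup>2)) \<in> borel_measurable borel"
      using measurable_compose[OF _ measurable_l, of "\<lambda>z :: real ^ 'n. (1 - \<omega>) * (norm z)\<^sup>2" borel] omega
      by (simp add: max_def)
    note [measurable] = lU lV
    \<comment> \<open>The substitution of z + \<theta> for x moves the parameter from the density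
      into the loss, leaving a fixed radial weight.\<close>
    have shift: "risk f l \<omega> (\<lambda>x. x) \<theta> \<delta> = (\<integral>\<^sup>+ z. ennreal (F z * H (z + \<theta>)) \<partial>lborel)"
      if H: "\<And>x. balanced_loss l \<omega> (\<lambda>x. x) \<theta> \<delta> x = H x" "\<And>x. H x \<ge> 0" "H \<in> borel_measurable borel" for \<delta> H
    proof -
      note [measurable] = H(3)
      have "risk f l \<omega> (\<lambda>x. x) \<theta> \<delta> = (\<integral>\<^sup>+ x. ennreal (F (x - \<theta>)) * ennreal (H x) \<partial>lborel)"
        unfolding risk_def law by (subst nn_integral_density) (auto simp: H(1) H(3))
      also have "\<dots> = (\<integral>\<^sup>+ z. ennreal (F (z + \<theta> - \<theta>)) * ennreal (H (z + \<theta>)) \<partial>lborel)"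
        by (rule nn_integral_lborel_shift[symmetric]) measurable
      finally show ?thesis by (simp add: ennreal_mult F0 H(2))
    qed
    have r1: "risk f l \<omega> (\<lambda>x. x) \<theta> (shrinkage_estimator \<omega> a s) = (\<integral>\<^sup>+ z. ennreal (F z * l (U (z + \<theta>))) \<partial>lborel)"
      by (rule shift) (use U0 l_nonneg lU in \<open>auto simp: balanced_loss_def estimator U_def k_def\<close>)
    have r0: "risk f l \<omega> (\<lambda>x. x) \<theta> (\<lambda>x. x) = (\<integral>\<^sup>+ z. ennreal (F z * l ((1 - \<omega>) * (norm (z + \<theta> - \<theta>))\<^sup>2)) \<partial>lborel)"
    proof (rule shift)
      show "(\<lambda>x. l ((1 - \<omega>) * (norm (x - \<theta>))\<^sup>2)) \<in> borel_measurable borel"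
        using measurable_compose[OF _ lV, of "\<lambda>x. x - \<theta>" borel] by simp
    qed (use l_nonneg omega in \<open>auto simp: balanced_loss_def\<close>)
    define G where "G z = w (norm z) * (s0 ((norm (z + \<theta>))\<^sup>2) / (norm (z + \<theta>))\<^sup>2 * (a - 2 * inner z (z + \<theta>)))" for z
    have G: "integrable lborel G" "(\<integral>z. G z \<partial>lborel) < 0"
      unfolding G_def using weighted_shrinkage_negative[where 'a = "real ^ 'n", OF _ nz a_pos w_meas w iw iw2] dim bound
      unfolding C_def J_def by auto
    let ?g0 = "\<lambda>z. F z * l ((1 - \<omega>) * (norm z)\<^sup>2)" and ?g1 = "\<lambda>z. F z * l (U (z + \<theta>))"
    have g0: "integrable lborel ?g0"
    proof (rule Bochner_Integration.integrable_bound)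
      show "integrable lborel (\<lambda>z. l 1 * F z + deriv l 1 * (1 - \<omega>) * (F z * (norm z)\<^sup>2))"
        by (intro Bochner_Integration.integrable_add integrable_mult_right iF iF2)
      show "AE z in lborel. norm (?g0 z) \<le> norm (l 1 * F z + deriv l 1 * (1 - \<omega>) * (F z * (norm z)\<^sup>2))"
      proof (rule AE_I2)
        fix z
        have "?g0 z \<le> F z * (l 1 + deriv l 1 * ((1 - \<omega>) * (norm z)\<^sup>2))"
          using omega by (intro mult_left_mono l_linear_bound F0) simp
        also have "\<dots> = l 1 * F z + deriv l 1 * (1 - \<omega>) * (F z * (norm z)\<^sup>2)" by (simp add: algebra_simps)
        finally show "norm (?g0 z) \<le> norm (l 1 * F z + deriv l 1 * (1 - \<omega>) * (F z * (norm z)\<^sup>2))"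
          using F0[of z] l_nonneg omega by simp
      qed
    qed measurable
    \<comment> \<open>The tangent to \<open>l\<close> is taken at \<open>?v\<close>, the loss
      argument of the unshrunk estimator; \<open>z \<noteq> 0\<close> makes it positive. The slope
      times the density is \<open>w\<close>.\<close>
    have le: "?g1 z \<le> ?g0 z + a * (1 - \<omega>)\<^sup>2 * G z" if z: "z \<noteq> 0" for z
    proof -
      let ?v = "(1 - \<omega>) * (norm z)\<^sup>2"
      have v: "?v > 0" using z omega by simp
      have "U (z + \<theta>) - ?v \<le> a * (1 - \<omega>)\<^sup>2 * (s0 ((norm (z + \<theta>))\<^sup>2) / (norm (z + \<theta>))\<^sup>2 * (a - 2 * inner z (z + \<theta>)))"
        using shrinkage_excess_le[OF omega a_pos, of "s0 ((norm (z + \<theta>))\<^sup>2)" "z + \<theta>" z] s01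
        unfolding U_def k_def by simp
      from mult_left_mono[OF this, of "deriv l ?v"]
      have "l (U (z + \<theta>)) \<le> l ?v + deriv l ?v * (a * (1 - \<omega>)\<^sup>2 * (s0 ((norm (z + \<theta>))\<^sup>2) / (norm (z + \<theta>))\<^sup>2 * (a - 2 * inner z (z + \<theta>))))"
        using tangent_bound[OF v U0, of "z + \<theta>"] l_deriv_pos v by (simp add: less_imp_le)
      from mult_left_mono[OF this F0[of z]] show ?thesis
        unfolding G_def wF[OF z] distrib_left by (simp only: mult_ac)
    qed
    \<comment> \<open>Although \<open>G\<close> changes sign, \<open>?g1\<close> is nonnegative and
      thus dominated by its integrable upper bound.\<close>
    have g1: "integrable lborel ?g1"
    proof (rule Bochner_Integration.integrable_bound)
      show "integrable lborel (\<lambda>z. ?g0 z + a * (1 - \<omega>)\<^sup>2 * G z)"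
        by (intro Bochner_Integration.integrable_add integrable_mult_right g0 G)
      show "AE z in lborel. norm (?g1 z) \<le> norm (?g0 z + a * (1 - \<omega>)\<^sup>2 * G z)"
        using z0
      proof eventually_elim
        fix z :: "real ^ 'n" assume "z \<noteq> 0"
        from le[OF this] show "norm (?g1 z) \<le> norm (?g0 z + a * (1 - \<omega>)\<^sup>2 * G z)"
          using F0[of z] l_nonneg U0[of "z + \<theta>"] by simp
      qed
    qed measurable
    have "(\<integral>z. ?g1 z \<partial>lborel) \<le> (\<integral>z. ?g0 z + a * (1 - \<omega>)\<^sup>2 * G z \<partial>lborel)"
      by (rule integral_mono_AE[OF g1], intro Bochner_Integration.integrable_add integrable_mult_right g0 G,
          use z0 in eventually_elim) (rule le)
    also have "\<dots> = (\<integral>z. ?g0 z \<partial>lborel) + a * (1 - \<omega>)\<^sup>2 * (\<integral>z. G z \<partial>lborel)"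
      by (subst Bochner_Integration.integral_add) (use g0 G in auto)
    also have "\<dots> < (\<integral>z. ?g0 z \<partial>lborel)"
      using a_pos omega G(2) by (simp add: mult_pos_neg)
    finally have lt: "(\<integral>z. ?g1 z \<partial>lborel) < (\<integral>z. ?g0 z \<partial>lborel)" .
    have g1_0: "0 \<le> (\<integral>z. ?g1 z \<partial>lborel)"
      by (rule integral_nonneg_AE) (simp add: F0 U0 l_nonneg)
    have "risk f l \<omega> (\<lambda>x. x) \<theta> (shrinkage_estimator \<omega> a s) = ennreal (\<integral>z. ?g1 z \<partial>lborel)"
      unfolding r1 by (rule nn_integral_eq_integral[OF g1]) (simp add: F0 U0 l_nonneg)
    moreover have "risk f l \<omega> (\<lambda>x. x) \<theta> (\<lambda>x. x) = ennreal (\<integral>z. ?g0 z \<partial>lborel)"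
      unfolding r0 add_diff_cancel_right' by (rule nn_integral_eq_integral[OF g0]) (use omega in \<open>simp add: F0 l_nonneg\<close>)
    ultimately show ?thesis using lt g1_0 by (simp add: ennreal_less_iff)
  qed
  then show ?thesis unfolding dominates_def by (auto intro: less_imp_le)
qed

end
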